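(* Let $N\ge 2$ and let $\{g_i\}_{i\in\mathcal I_N}$ be an LF system normalized by $d_i=1$, with associated probability vectors $\mathfrak p_i\in\overline{\mathcal P_N}$, $i\in\mathcal I_N$. If the set $\{\mathfrak p_i : i\in\mathcal I_N\}$ has at least two elements, then for every $\epsilon\in(0,1/2)$ there exists $\delta>0$ such that the following holds: for every contractive system $\{f_i\}_{i\in\mathcal I_N}$ on $[0,1]$ such that, with $r_i:=\|f_i\|_{\mathrm{Lip}}$, $\sum_{i\in\mathcal I_N} r_i<1+\delta$ and $\epsilon\le r_i\le 1-\epsilon$ for each $i\in\mathcal I_N$, one has $\dim_H\mu_\varphi<1$, where $\varphi$ is the unique continuous strictly increasing solution $\varphi:[0,1]\to[0,1]$ of $g_i\circ\varphi=\varphi\circ f_i$ ($i\in\mathcal I_N$) and $\mu_\varphi$ is the Borel probability measure on $[0,1]$ with distribution function $\varphi$.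
   Context: Let $N\ge2$ and $\mathcal I_N=\{0,1,\dots,N-1\}$. A compatible system on $[0,1]$ is a family $\{h_i\}_{i\in\mathcal I_N}$ of strictly increasing continuous functions $h_i:[0,1]\to[0,1]$ with $h_0(0)=0$, $h_{i-1}(1)=h_i(0)$ for $1\le i\le N-1$, and $h_{N-1}(1)=1$. For $h:[0,1]\to[0,1]$, $\|h\|_{\mathrm{Lip}}:=\sup_{x\ne y}|h(x)-h(y)|/|x-y|$; $h$ is a contraction if $\|h\|_{\mathrm{Lip}}<1$. A contractive system on $[0,1]$ is a compatible system all of whose members are contractions. An LF system normalized by $d_i=1$ is a family $g_i(x)=\frac{a_ix+b_i}{c_ix+1}$, $x\in[0,1]$, $i\in\mathcal I_N$, with real numbers $a_i,b_i,c_i$ such that, for all $i\in\mathcal I_N$: (1) $c_i+1>0$; (2) $0<a_i-b_ic_i\le\min\{1,(c_i+1)^2\}$; (3) $b_0=0$ and $\frac{a_i+b_i}{c_i+1}=b_{i+1}$, where $b_N:=1$. (These imply $0=b_0<b_1<\dots<b_N=1$, $0<a_0\le1$ and $(1-a_i)^2+4b_ic_i\ge0$.) For $\{f_i\}$ a contractive system and $\{g_i\}$ an LF system, the equation $g_i\circ\varphi=\varphi\circ f_i$ $(i\in\mathcal I_N)$ has a unique continuous strictly increasing solution $\varphi:[0,1]\to[0,1]$. From $\{g_i\}$ define: $\alpha$ is the minimum and $\beta$ the maximum of the numbers $0$, $\frac{c_0}{1-a_0}$, and $\frac{a_i-1+\sqrt{(1-a_i)^2+4b_ic_i}}{2b_i}$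 $(1\le i\le N-1)$, where, if $a_0=1$, the number $\frac{c_0}{1-a_0}$ is omitted in the definition of $\alpha$ and is taken to be $+\infty$ in the definition of $\beta$. Then $Y:=[\alpha,\beta]\subset[-1,+\infty]$ (with $+\infty$ added as compactification point if $\beta=+\infty$). For $y\in Y$ and $i\in\mathcal I_N$ put $$G_i(y)=\frac{(b_{i+1}-b_i)(y+1)}{(b_{i+1}y+1)(b_iy+1)},\qquad H_i(y)=\frac{a_iy+c_i}{b_iy+1},$$ where for $i=N-1$ the first expression is understood in the simplified form $G_{N-1}(y)=\frac{1-b_{N-1}}{b_{N-1}y+1}$, and $G_0(+\infty)=1$, $G_i(+\infty)=0$ $(i\ge1)$, $H_0(+\infty)=+\infty$, $H_i(+\infty)=a_i/b_i$ $(i\ge1)$. Then $G_i:Y\to[0,1]$ and $H_i:Y\to Y$ are continuous and $\sum_iG_i(y)=1$. Each $H_i$ has exactly one fixed point in $Y$, denoted $\mathrm{Fix}(H_i)$: it is $\frac{c_0}{1-a_0}$ for $i=0$ ($+\infty$ if $a_0=1$) and $\frac{a_i-1+\sqrt{(1-a_i)^2+4b_ic_i}}{2b_i}$ for $i\ge1$. $\overline{\mathcal P_N}=\{(p_i)_{i\in\mathcal I_N}:p_i\ge0,\sum_ip_i=1\}$, $\mathbf G(y)=(G_0(y),\dots,G_{N-1}(y))\in\overline{\mathcal P_N}$, and $\mathfrak p_i:=\mathbf G(\mathrm{Fix}(H_i))$. For a Borel probability measure $\mu$ on $[0,1]$, $\dim_H\mu:=\inf\{\dim_HA: A\subset[0,1]\text{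 Borel},\ \mu(A)=1\}$, where $\dim_H A$ is Hausdorff dimension. *)

theory Defs
  imports "HOL-Analysis.Analysis"
begin

section \<open>Hausdorff dimension\<close>

text \<open>
  Only exponents \<open>s > 0\<close> are used below: \<open>0 powr 0 = 0\<close> in HOL, so
  \<open>hausdorff_measure 0\<close> would not be the counting measure. The value of \<open>hausdorff_dim\<close>
  is unaffected by leaving out \<open>s = 0\<close>. Covering sets may be empty, so countable covers
  include the finite ones; boundedness is required because \<open>diameter\<close> is not meaningful
  on unbounded sets.
\<close>

definition hausdorff_premeasure :: "real \<Rightarrow> real \<Rightarrow> 'a::metric_space set \<Rightarrow> ennreal" where
  "hausdorff_premeasure s \<rho> A =
     (INF U \<in> {U :: nat \<Rightarrow> 'a set. A \<subseteq> (\<Union>n. U n) \<and> (\<forall>n. bounded (U n) \<and> diameter (U n) \<le> \<rho>)}.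
        \<Sum>n. ennreal (diameter (U n) powr s))"

definition hausdorff_measure :: "real \<Rightarrow> 'a::metric_space set \<Rightarrow> ennreal" where
  "hausdorff_measure s A = (SUP \<rho> \<in> {0<..}. hausdorff_premeasure s \<rho> A)"

definition hausdorff_dim :: "'a::metric_space set \<Rightarrow> ereal" where
  "hausdorff_dim A = (INF s \<in> {s. 0 < s \<and> hausdorff_measure s A = 0}. ereal s)"

definition hausdorff_dim_measure :: "'a::metric_space measure \<Rightarrow> ereal" where
  "hausdorff_dim_measure \<mu> = (INF A \<in> {A \<in> sets \<mu>. emeasure \<mu> A = 1}. hausdorff_dim A)"


section \<open>Contractive systems on the unit interval\<close>

text \<open>
  Self-maps of \<open>[0,1]\<close> are represented by functions on the reals, of which only the values on
  \<open>{0..1}\<close> matter; a family indexed by \<open>{0,\<dots>,N-1}\<close> is a function on \<open>nat\<close>, of which only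
  the values at \<open>i < N\<close> matter.
\<close>

definition increasing_self_map :: "(real \<Rightarrow> real) \<Rightarrow> bool" where
  "increasing_self_map h \<longleftrightarrow>
     h ` {0..1} \<subseteq> {0..1} \<and> continuous_on {0..1} h \<and> strict_mono_on {0..1} h"

definition compatible_system :: "nat \<Rightarrow> (nat \<Rightarrow> real \<Rightarrow> real) \<Rightarrow> bool" where
  "compatible_system N h \<longleftrightarrow>
     (\<forall>i<N. increasing_self_map (h i)) \<and>
     h 0 0 = 0 \<and> (\<forall>i\<in>{1..N - 1}. h (i - 1) 1 = h i 0) \<and> h (N - 1) 1 = 1"

definition lip_norm :: "(real \<Rightarrow> real) \<Rightarrow> ereal" where
  "lip_norm h = (SUP (x, y) \<in> {(x, y). x \<in> {0..1} \<and> y \<in> {0..1} \<and> x \<noteq> y}.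
                   ereal (\<bar>h x - h y\<bar> / \<bar>x - y\<bar>))"

definition contractive_system :: "nat \<Rightarrow> (nat \<Rightarrow> real \<Rightarrow> real) \<Rightarrow> bool" where
  "contractive_system N f \<longleftrightarrow> compatible_system N f \<and> (\<forall>i<N. lip_norm (f i) < 1)"


section \<open>Linear fractional systems normalized by \<open>d\<^sub>i = 1\<close>\<close>

definition lf_map :: "(nat \<Rightarrow> real) \<Rightarrow> (nat \<Rightarrow> real) \<Rightarrow> (nat \<Rightarrow> real) \<Rightarrow> nat \<Rightarrow> real \<Rightarrow> real" where
  "lf_map a b c i x = (a i * x + b i) / (c i * x + 1)"

text \<open>
  The sequence \<open>b\<close> carries the additional entry \<open>b N = 1\<close>, which is the convention
  \<open>b\<^sub>N := 1\<close> and not a restriction on the maps with index \<open>i < N\<close>.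
\<close>

definition lf_system ::
  "nat \<Rightarrow> (nat \<Rightarrow> real) \<Rightarrow> (nat \<Rightarrow> real) \<Rightarrow> (nat \<Rightarrow> real) \<Rightarrow> bool" where
  "lf_system N a b c \<longleftrightarrow>
     (\<forall>i<N. c i + 1 > 0) \<and>
     (\<forall>i<N. 0 < a i - b i * c i \<and> a i - b i * c i \<le> min 1 ((c i + 1)\<^sup>2)) \<and>
     b 0 = 0 \<and> b N = 1 \<and> (\<forall>i<N. (a i + b i) / (c i + 1) = b (i + 1))"

text \<open>The numbers of which \<open>\<alpha>\<close> and \<open>\<beta>\<close> are the minimum and the maximum.\<close>

definition lf_crit :: "(nat \<Rightarrow> real) \<Rightarrow> (nat \<Rightarrow> real) \<Rightarrow> (nat \<Rightarrow> real) \<Rightarrow> nat \<Rightarrow> ereal" where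
  "lf_crit a b c i =
     (if i = 0 then (if a 0 = 1 then \<infinity> else ereal (c 0 / (1 - a 0)))
      else ereal ((a i - 1 + sqrt ((1 - a i)\<^sup>2 + 4 * b i * c i)) / (2 * b i)))"

definition lf_alpha ::
  "nat \<Rightarrow> (nat \<Rightarrow> real) \<Rightarrow> (nat \<Rightarrow> real) \<Rightarrow> (nat \<Rightarrow> real) \<Rightarrow> ereal" where
  "lf_alpha N a b c = Min (insert 0 (lf_crit a b c ` {i. i < N \<and> \<not> (i = 0 \<and> a 0 = 1)}))"

definition lf_beta ::
  "nat \<Rightarrow> (nat \<Rightarrow> real) \<Rightarrow> (nat \<Rightarrow> real) \<Rightarrow> (nat \<Rightarrow> real) \<Rightarrow> ereal" where
  "lf_beta N a b c = Max (insert 0 (lf_crit a b c ` {..<N}))"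

definition lf_Y ::
  "nat \<Rightarrow> (nat \<Rightarrow> real) \<Rightarrow> (nat \<Rightarrow> real) \<Rightarrow> (nat \<Rightarrow> real) \<Rightarrow> ereal set" where
  "lf_Y N a b c = {lf_alpha N a b c .. lf_beta N a b c}"

text \<open>
  The point \<open>-\<infinity>\<close> never lies in \<open>Y\<close>; the values of \<open>G\<close> and \<open>H\<close> there are irrelevant.
\<close>

definition lf_G :: "nat \<Rightarrow> (nat \<Rightarrow> real) \<Rightarrow> nat \<Rightarrow> ereal \<Rightarrow> real" where
  "lf_G N b i y =
     (case y of
        ereal t \<Rightarrow>
          if i = N - 1 then (1 - b i) / (b i * t + 1)
          else (b (i + 1) - b i) * (t + 1) / ((b (i + 1) * t + 1) * (b i * t + 1))
      | PInfty \<Rightarrow> if i = 0 then 1 else 0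
      | MInfty \<Rightarrow> 0)"

definition lf_H ::
  "(nat \<Rightarrow> real) \<Rightarrow> (nat \<Rightarrow> real) \<Rightarrow> (nat \<Rightarrow> real) \<Rightarrow> nat \<Rightarrow> ereal \<Rightarrow> ereal" where
  "lf_H a b c i y =
     (case y of
        ereal t \<Rightarrow> ereal ((a i * t + c i) / (b i * t + 1))
      | PInfty \<Rightarrow> if i = 0 then \<infinity> else ereal (a i / b i)
      | MInfty \<Rightarrow> 0)"

definition lf_fix ::
  "nat \<Rightarrow> (nat \<Rightarrow> real) \<Rightarrow> (nat \<Rightarrow> real) \<Rightarrow> (nat \<Rightarrow> real) \<Rightarrow> nat \<Rightarrow> ereal" where
  "lf_fix N a b c i = (THE y. y \<in> lf_Y N a b c \<and> lf_H a b c i y = y)"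

text \<open>
  The probability vector \<open>\<pp>\<^sub>i\<close>, restricted to the index set \<open>{..<N}\<close> so that equality of
  functions is equality of vectors.
\<close>

definition lf_prob ::
  "nat \<Rightarrow> (nat \<Rightarrow> real) \<Rightarrow> (nat \<Rightarrow> real) \<Rightarrow> (nat \<Rightarrow> real) \<Rightarrow> nat \<Rightarrow> nat \<Rightarrow> real" where
  "lf_prob N a b c i = (\<lambda>j\<in>{..<N}. lf_G N b j (lf_fix N a b c i))"


section \<open>The conjugating function and its measure\<close>

definition conjugacy ::
  "nat \<Rightarrow> (nat \<Rightarrow> real \<Rightarrow> real) \<Rightarrow> (nat \<Rightarrow> real \<Rightarrow> real) \<Rightarrow> (real \<Rightarrow> real) \<Rightarrow> bool" where
  "conjugacy N g f \<phi> \<longleftrightarrow>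
     increasing_self_map \<phi> \<and> (\<forall>i<N. \<forall>x\<in>{0..1}. g i (\<phi> x) = \<phi> (f i x))"

text \<open>
  The argument of \<open>\<phi>\<close> is clamped to \<open>[0,1]\<close>, which extends \<open>\<phi>\<close> by \<open>\<phi> 0\<close> to the left and by
  \<open>\<phi> 1\<close> to the right. Solutions of the conjugacy equation satisfy \<open>\<phi> 0 = 0\<close> and \<open>\<phi> 1 = 1\<close>.
\<close>

definition dist_measure :: "(real \<Rightarrow> real) \<Rightarrow> real measure" where
  "dist_measure \<phi> = restrict_space (interval_measure (\<lambda>x. \<phi> (max 0 (min 1 x)))) {0..1}"

lemma dist_measure_cdf:
  assumes \<phi>: "increasing_self_map \<phi>" and 0: "\<phi> 0 = 0" and x: "x \<in> {0..1}"
  shows "emeasure (dist_measure \<phi>) {0..x} = ennreal (\<phi> x)"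
proof -
  define F where "F = (\<lambda>x. \<phi> (max 0 (min 1 x)))"
  have sm: "strict_mono_on {0..1} \<phi>" and co: "continuous_on {0..1} \<phi>"
    using \<phi> unfolding increasing_self_map_def by blast+
  have mono: "F s \<le> F t" if "s \<le> t" for s t
    unfolding F_def by (rule strict_mono_on_leD[OF sm]) (use that in auto)
  have cont: "continuous_on UNIV F"
    unfolding F_def
    by (rule continuous_on_compose2[OF co]) (intro continuous_intros, auto)
  have "emeasure (dist_measure \<phi>) {0..x} = emeasure (interval_measure F) {0..x}"
    unfolding dist_measure_def F_def[symmetric]
    by (rule emeasure_restrict_space) (use x in auto)
  also have "\<dots> = ennreal (F x - F 0)"
    by (rule emeasure_interval_measure_Icc) (use x mono cont in auto)
  finally show ?thesis using x 0 by (simp add: F_def)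
qed

end

theory Submission
  imports Defs
begin

text \<open>
  Write \<open>f\<^sub>w = f\<^bsub>w\<^sub>1\<^esub> \<circ> \<dots> \<circ> f\<^bsub>w\<^sub>n\<^esub>\<close> for a word \<open>w\<close>. By the conjugacy equation the measure of the cylinder
  \<open>f\<^sub>w[0,1]\<close> is \<open>\<nu>(w) = g\<^sub>w(1) - g\<^sub>w(0)\<close>, and its length is at most \<open>r\<^sub>w = \<Prod> r\<^bsub>w\<^sub>k\<^esub>\<close>. The
  numbers \<open>\<nu>(w)\<close> are path probabilities: \<open>\<nu> = \<nu>\<^sub>0\<close>, where
  \<open>\<nu>\<^sub>y(i w) = G\<^sub>i(y) \<nu>\<^bsub>H\<^sub>i(y)\<^esub>(w)\<close> for states \<open>y > -1\<close>.

  The dimension is controlled by the affinity sums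
  \<open>S\<^sub>n(y) = \<Sum>\<^bsub>|w|=n\<^esub> sqrt (\<nu>\<^sub>y(w) r\<^sub>w\<^sup>s)\<close>. If \<open>S\<^bsub>kn\<^esub>(0) \<le> \<rho>\<^sup>n\<close> with \<open>\<rho> < 1\<close>, then by Markov's
  inequality the words \<open>w\<close> of length \<open>kn\<close> with \<open>r\<^sub>w\<^sup>s > \<rho>\<^sup>n \<nu>(w)\<close> carry mass at most \<open>\<rho>\<^bsup>n/2\<^esup>\<close>;
  the other cylinders of that level satisfy \<open>\<Sum> r\<^sub>w\<^sup>s \<le> \<rho>\<^sup>n\<close>. So the points lying in infinitely
  many of these good cylinders form a set of full measure whose \<open>s\<close>-dimensional Hausdorff
  measure is zero (\<open>hausdorff_dim_dist_measure_le\<close>).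

  To bound \<open>S\<^bsub>2n\<^esub>\<close> it suffices to bound the two-step sum at \<open>s = 1\<close>,
  \<open>\<Sum>\<^sub>i sqrt (G\<^sub>i(y) r\<^sub>i) \<Sum>\<^sub>j sqrt (G\<^sub>j(H\<^sub>i y) r\<^sub>j)\<close>, by a constant below \<open>1\<close> uniformly in \<open>y > -1\<close>:
  as \<open>r\<^sub>i \<ge> \<epsilon>\<close>, passing to a slightly smaller exponent \<open>s\<close> costs only a factor close to \<open>1\<close>. From
  \<open>sqrt (p r) = (p + r)/2 - (sqrt p - sqrt r)\<^sup>2/2\<close>, each of the inner and outer sums is at most
  \<open>1 + \<delta>/2\<close>, and smaller by a definite amount when \<open>G(y)\<close>, respectively \<open>G(H\<^sub>i y)\<close>, is away from
  \<open>r\<close>. The vectors \<open>G(y)\<close> and \<open>G(H\<^sub>i y)\<close>, for all \<open>i\<close>, cannot all be close to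
  \<open>r\<close>: the last weight
  \<open>G\<^bsub>N-1\<^esub>(y) = (1 - b\<^bsub>N-1\<^esub>) / (b\<^bsub>N-1\<^esub> y + 1)\<close> is injective in \<open>y\<close>, so that \<open>G(H\<^sub>i y) = G(y)\<close>
  for all \<open>i\<close> would make \<open>y\<close> a common fixed point of all \<open>H\<^sub>i\<close>, and then all vectors
  \<open>\<pp>\<^sub>i\<close> would coincide (\<open>lf_prob_const_of_common_fixed_point\<close>). Compactness of the closed
  range of the coordinate \<open>1 / (b\<^bsub>N-1\<^esub> y + 1)\<close> makes this quantitative (\<open>G_gap\<close>).
\<close>


section \<open>Limsup sets of Hausdorff measure zero\<close>

lemma hausdorff_measure_limsup_eq_0:
  fixes V :: "'i::countable \<Rightarrow> 'a::metric_space set" and W :: "nat \<Rightarrow> 'i set"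
  assumes fin: "\<And>n. finite (W n)"
    and bdd: "\<And>w. bounded (V w)"
    and \<kappa>: "0 \<le> \<kappa>" "\<kappa> < 1" and diam: "\<And>n w. w \<in> W n \<Longrightarrow> diameter (V w) \<le> \<kappa> ^ n"
    and \<theta>: "0 \<le> \<theta>" "\<theta> < 1" and sums: "\<And>n. (\<Sum>w\<in>W n. diameter (V w) powr s) \<le> \<theta> ^ n"
  shows "hausdorff_measure s (\<Inter>m. \<Union>n\<in>{m..}. \<Union>w\<in>W n. V w) = 0"
proof -
  let ?A = "\<Inter>m. \<Union>n\<in>{m..}. \<Union>w\<in>W n. V w"
  have "hausdorff_premeasure s d ?A \<le> 0" if d: "d > 0" for d
  proof (rule ennreal_le_epsilon)
    fix e :: real assume e: "e > 0"
    have "(\<lambda>m. \<theta> ^ m / (1 - \<theta>)) \<longlonglongrightarrow> 0 / (1 - \<theta>)"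
      by (intro tendsto_intros LIMSEQ_power_zero) (use \<theta> in auto)
    then have "\<forall>\<^sub>F m in sequentially. \<theta> ^ m / (1 - \<theta>) < e"
      using e by (intro order_tendstoD(2)) auto
    moreover have "\<forall>\<^sub>F m in sequentially. \<kappa> ^ m < d"
      using d \<kappa> by (intro order_tendstoD(2)[OF LIMSEQ_power_zero]) auto
    ultimately have "\<forall>\<^sub>F m in sequentially. \<theta> ^ m / (1 - \<theta>) < e \<and> \<kappa> ^ m < d"
      by eventually_elim simp
    then obtain m where m: "\<theta> ^ m / (1 - \<theta>) < e" "\<kappa> ^ m < d"
      by (auto simp: eventually_sequentially)
    define P where "P = {(n, w). m \<le> n \<and> w \<in> W n}"
    define U where "U k = (if k \<in> to_nat ` P then V (snd (from_nat k :: nat \<times> 'i)) else {})" for k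
    have cover: "?A \<subseteq> (\<Union>k. U k)"
    proof
      fix x assume "x \<in> ?A"
      then obtain n w where "n \<ge> m" "w \<in> W n" "x \<in> V w" by fastforce
      then have "x \<in> U (to_nat (n, w))" by (auto simp: U_def P_def)
      then show "x \<in> (\<Union>k. U k)" by blast
    qed
    have small: "bounded (U k) \<and> diameter (U k) \<le> d" for k
    proof (cases "k \<in> to_nat ` P")
      case True
      then obtain n w where nw: "m \<le> n" "w \<in> W n" "k = to_nat (n, w)" by (auto simp: P_def)
      have "diameter (V w) \<le> \<kappa> ^ n" by (rule diam) fact
      also have "\<dots> \<le> \<kappa> ^ m" using nw \<kappa> by (intro power_decreasing) auto
      finally show ?thesis using True nw m bdd by (auto simp: U_def)
    qed (use d in \<open>auto simp: U_def\<close>)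
    have "(\<Sum>k<K. ennreal (diameter (U k) powr s)) \<le> ennreal e" for K
    proof -
      define F where "F = {p \<in> P. to_nat p < K}"
      have finF: "finite F"
        by (rule finite_imageD[of to_nat]) (auto simp: F_def intro: finite_subset[of _ "{..<K}"])
      obtain M where M: "\<And>n w. (n, w) \<in> F \<Longrightarrow> n < M"
        using finite_nat_set_iff_bounded[of "fst ` F"] finF by (metis finite_imageI fst_conv image_eqI)
      have "(\<Sum>k<K. diameter (U k) powr s) = (\<Sum>k\<in>to_nat ` F. diameter (U k) powr s)"
        by (rule sum.mono_neutral_right) (auto simp: F_def U_def)
      also have "\<dots> = (\<Sum>p\<in>F. diameter (V (snd p)) powr s)"
        by (subst sum.reindex) (auto simp: F_def U_def inj_on_def intro!: sum.cong)
      also have "\<dots> \<le> (\<Sum>p\<in>Sigma {m..<M} W. diameter (V (snd p)) powr s)"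
        by (rule sum_mono2) (use M fin in \<open>auto simp: F_def P_def\<close>)
      also have "\<dots> = (\<Sum>n\<in>{m..<M}. \<Sum>w\<in>W n. diameter (V w) powr s)"
        by (subst sum.Sigma) (use fin in \<open>auto simp: split_def\<close>)
      also have "\<dots> \<le> (\<Sum>n\<in>{m..<M}. \<theta> ^ n)" by (intro sum_mono sums)
      also have "\<dots> \<le> \<theta> ^ m / (1 - \<theta>)"
      proof (cases "m \<le> M")
        case True
        then have "(\<Sum>n\<in>{m..<M}. \<theta> ^ n) = (\<theta> ^ m - \<theta> ^ M) / (1 - \<theta>)"
          using \<theta> sum_gp[of \<theta> m "M - 1"] 
          by (cases M) (auto simp: atLeastLessThanSuc_atLeastAtMost le_Suc_eq sum_gp)
        then show ?thesis using \<theta> by (simp add: divide_right_mono)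
      qed (use \<theta> in auto)
      finally show ?thesis using m by (subst sum_ennreal) (auto intro: ennreal_leI)
    qed
    then have "(\<Sum>k. ennreal (diameter (U k) powr s)) \<le> ennreal e"
      by (simp add: suminf_eq_SUP SUP_least)
    then have "hausdorff_premeasure s d ?A \<le> ennreal e"
      unfolding hausdorff_premeasure_def
      by (intro INF_lower2[of U]) (use cover small in auto)
    then show "hausdorff_premeasure s d ?A \<le> 0 + ennreal e" by simp
  qed
  then show ?thesis unfolding hausdorff_measure_def by (simp add: SUP_eq_iff)
qed

section \<open>Words and cylinders of a compatible system\<close>

lemma increasing_self_mapD:
  assumes "increasing_self_map h"
  shows "x \<in> {0..1} \<Longrightarrow> h x \<in> {0..1}"
    and "x \<in> {0..1} \<Longrightarrow> y \<in> {0..1} \<Longrightarrow> x < y \<Longrightarrow> h x < h y"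
    and "x \<in> {0..1} \<Longrightarrow> y \<in> {0..1} \<Longrightarrow> x \<le> y \<Longrightarrow> h x \<le> h y"
    and "continuous_on {0..1} h"
  using assms unfolding increasing_self_map_def
  by (blast, blast dest: strict_mono_onD, blast intro: strict_mono_on_leD, blast)

text \<open>The words of length \<open>n\<close> over the alphabet \<open>{0,\<dots>,N-1}\<close>.\<close>

definition words :: "nat \<Rightarrow> nat \<Rightarrow> nat list set" where
  "words N n = {w. set w \<subseteq> {..<N} \<and> length w = n}"

text \<open>
  The composition along a word; the first letter is the outermost map, so that appending letters
  refines a cylinder and prefixing them applies a map to it.
\<close>

definition word_map :: "(nat \<Rightarrow> 'a \<Rightarrow> 'a) \<Rightarrow> nat list \<Rightarrow> 'a \<Rightarrow> 'a" where
  "word_map f w = foldr f w"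

text \<open>The product of the weights of the letters, an upper bound for the length of a cylinder.\<close>

definition word_weight :: "(nat \<Rightarrow> real) \<Rightarrow> nat list \<Rightarrow> real" where
  "word_weight r w = (\<Prod>i\<leftarrow>w. r i)"

lemma finite_words [simp]: "finite (words N n)"
  unfolding words_def by (rule finite_lists_length_eq) simp

lemma words_0 [simp]: "words N 0 = {[]}"
  by (auto simp: words_def)

lemma words_Suc: "words N (Suc n) = (\<lambda>(i, w). i # w) ` ({..<N} \<times> words N n)"
  by (fastforce simp: words_def length_Suc_conv image_iff)

lemma sum_words_Suc: "(\<Sum>w\<in>words N (Suc n). h w) = (\<Sum>i<N. \<Sum>w\<in>words N n. h (i # w))"
  unfolding words_Suc
  by (subst sum.reindex) (auto simp: inj_on_def sum.cartesian_product split_def o_def)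

lemma word_map_simps [simp]: "word_map f [] x = x" "word_map f (i # w) x = f i (word_map f w x)"
  by (simp_all add: word_map_def)

lemma word_weight_simps [simp]:
  "word_weight r [] = 1" "word_weight r (i # w) = r i * word_weight r w"
  by (simp_all add: word_weight_def)

lemma Cons_in_words: "i # w \<in> words N (Suc n) \<longleftrightarrow> i < N \<and> w \<in> words N n"
  by (auto simp: words_def)

lemma word_weight_pos:
  assumes "\<And>i. i < N \<Longrightarrow> 0 < r i" "w \<in> words N n"
  shows "0 < word_weight r w"
  using assms(2) by (induction w arbitrary: n) (auto simp: words_def assms(1))

lemma word_weight_le_power:
  assumes "\<And>i. i < N \<Longrightarrow> 0 \<le> r i \<and> r i \<le> \<kappa>" "w \<in> words N n"
  shows "0 \<le> word_weight r w \<and> word_weight r w \<le> \<kappa> ^ n"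
  using assms(2)
proof (induction n arbitrary: w)
  case (Suc n)
  then obtain i v where w: "w = i # v" "i < N" "v \<in> words N n" by (auto simp: words_Suc)
  show ?case using Suc.IH[OF w(3)] assms(1)[OF w(2)] w by (auto intro: mult_mono)
qed simp

lemma increasing_self_map_word_map:
  assumes "\<And>i. i < N \<Longrightarrow> increasing_self_map (f i)" "w \<in> words N n"
  shows "increasing_self_map (word_map f w)"
  using assms(2)
proof (induction n arbitrary: w)
  case 0
  then show ?case by (simp add: increasing_self_map_def strict_mono_on_def image_subset_iff)
next
  case (Suc n)
  then obtain i v where w: "w = i # v" "i < N" "v \<in> words N n" by (auto simp: words_Suc)
  note v = increasing_self_mapD[OF Suc.IH[OF w(3)]]
  note i = increasing_self_mapD[OF assms(1)[OF w(2)]]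
  have "continuous_on {0..1} (\<lambda>x. f i (word_map f v x))"
    by (rule continuous_on_compose2[of "{0..1}" "f i"]) (use v(1,4) i(4) in blast)+
  moreover have "strict_mono_on {0..1} (\<lambda>x. f i (word_map f v x))"
    by (intro strict_mono_onI i(2) v(1,2))
  moreover have "(\<lambda>x. f i (word_map f v x)) ` {0..1} \<subseteq> {0..1}"
    using v(1) i(1) by blast
  moreover have "word_map f w = (\<lambda>x. f i (word_map f v x))" by (simp add: fun_eq_iff w(1))
  ultimately show ?case unfolding increasing_self_map_def by simp
qed

lemma compatible_system_cover:
  assumes comp: "compatible_system N f" and N: "N \<ge> 1" and x: "x \<in> {0..1}"
  shows "\<exists>i<N. x \<in> f i ` {0..1}"
proof -
  define i where "i = (GREATEST i. i < N \<and> f i 0 \<le> x)"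
  have ex: "0 < N \<and> f 0 0 \<le> x" using N comp x by (auto simp: compatible_system_def)
  have i: "i < N \<and> f i 0 \<le> x"
    unfolding i_def by (rule GreatestI_nat[of _ 0 N]) (use ex in auto)
  have le: "x \<le> f i 1"
  proof (cases "i = N - 1")
    case True
    then show ?thesis using comp x by (auto simp: compatible_system_def)
  next
    case False
    have "\<not> (Suc i < N \<and> f (Suc i) 0 \<le> x)"
      using Greatest_le_nat[of "\<lambda>i. i < N \<and> f i 0 \<le> x" "Suc i" N] by (auto simp: i_def)
    moreover have "f i 1 = f (Suc i) 0"
      using comp False i by (auto simp: compatible_system_def dest!: bspec[of _ _ "Suc i"])
    ultimately show ?thesis using False i by auto
  qed
  have "continuous_on {0..1} (f i)" using comp i by (auto simp: compatible_system_def increasing_self_map_def)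
  with IVT'[of "f i" 0 x 1] i le obtain t where "0 \<le> t" "t \<le> 1" "f i t = x" by auto
  then show ?thesis using i by (intro exI[of _ i]) auto
qed

lemma words_cover:
  assumes comp: "compatible_system N f" and N: "N \<ge> 1" and x: "x \<in> {0..1}"
  shows "\<exists>w\<in>words N n. x \<in> word_map f w ` {0..1}"
  using x
proof (induction n arbitrary: x)
  case (Suc n)
  from compatible_system_cover[OF comp N Suc.prems] obtain i t
    where i: "i < N" "t \<in> {0..1}" "x = f i t" by auto
  from Suc.IH[OF i(2)] obtain v u where v: "v \<in> words N n" "u \<in> {0..1}" "t = word_map f v u" by auto
  show ?case by (rule bexI[of _ "i # v"]) (use i v in \<open>auto simp: Cons_in_words\<close>)
qed simp

text \<open>
  The cylinders of each level tile \<open>[0,1]\<close>; stated for an arbitrary \<open>\<psi>\<close>, because the induction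
  replaces \<open>\<psi>\<close> by \<open>\<psi> \<circ> f i\<close>.
\<close>

lemma sum_words_increments:
  fixes f :: "nat \<Rightarrow> real \<Rightarrow> real" and \<psi> :: "real \<Rightarrow> real"
  assumes comp: "compatible_system N f" and N: "N \<ge> 1"
  shows "(\<Sum>w\<in>words N n. \<psi> (word_map f w 1) - \<psi> (word_map f w 0)) = \<psi> 1 - \<psi> 0"
proof (induction n arbitrary: \<psi>)
  case (Suc n)
  \<comment> \<open>the division points, with \<open>e N = 1\<close> so that the sum telescopes\<close>
  define e where "e i = (if i < N then f i 0 else 1)" for i
  have e: "f i 1 = e (Suc i)" "f i 0 = e i" if "i < N" for i
  proof -
    show "f i 1 = e (Suc i)"
    proof (cases "Suc i < N")
      case True
      then show ?thesis
        using comp by (auto simp: compatible_system_def e_def dest!: bspec[of _ _ "Suc i"])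
    next
      case False
      then have "i = N - 1" using that by simp
      then show ?thesis using comp False by (simp add: compatible_system_def e_def)
    qed
  qed (simp add: e_def that)
  have "(\<Sum>w\<in>words N (Suc n). \<psi> (word_map f w 1) - \<psi> (word_map f w 0)) = (\<Sum>i<N. \<psi> (f i 1) - \<psi> (f i 0))"
    unfolding sum_words_Suc using Suc.IH[of "\<lambda>x. \<psi> (f i x)" for i] by (intro sum.cong) auto
  also have "\<dots> = (\<Sum>i<N. \<psi> (e (Suc i)) - \<psi> (e i))" by (intro sum.cong) (auto simp: e)
  also have "\<dots> = \<psi> (e N) - \<psi> (e 0)" by (rule sum_lessThan_telescope)
  also have "\<dots> = \<psi> 1 - \<psi> 0" using comp N by (simp add: e_def compatible_system_def)
  finally show ?case .
qed simp

text \<open>The image of \<open>[0,1]\<close> under \<open>word_map f w\<close>, given by its end points.\<close>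

definition cylinder :: "(nat \<Rightarrow> real \<Rightarrow> real) \<Rightarrow> nat list \<Rightarrow> real set" where
  "cylinder f w = {word_map f w 0 .. word_map f w 1}"

lemma word_map_lipschitz:
  assumes self: "\<And>i. i < N \<Longrightarrow> increasing_self_map (f i)"
    and lip: "\<And>i x y. i < N \<Longrightarrow> x \<in> {0..1} \<Longrightarrow> y \<in> {0..1} \<Longrightarrow> \<bar>f i x - f i y\<bar> \<le> r i * \<bar>x - y\<bar>"
    and r: "\<And>i. i < N \<Longrightarrow> 0 \<le> r i"
    and w: "w \<in> words N n" and xy: "x \<in> {0..1}" "y \<in> {0..1}"
  shows "\<bar>word_map f w x - word_map f w y\<bar> \<le> word_weight r w * \<bar>x - y\<bar>"
  using w
proof (induction n arbitrary: w)
  case (Suc n)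
  then obtain i v where w: "w = i # v" "i < N" "v \<in> words N n" by (auto simp: words_Suc)
  have "word_map f v x \<in> {0..1}" "word_map f v y \<in> {0..1}"
    using increasing_self_mapD(1)[OF increasing_self_map_word_map[of N f, OF self w(3)]] xy by blast+
  then have "\<bar>f i (word_map f v x) - f i (word_map f v y)\<bar> \<le> r i * \<bar>word_map f v x - word_map f v y\<bar>"
    by (rule lip[OF w(2)])
  also have "\<dots> \<le> r i * (word_weight r v * \<bar>x - y\<bar>)"
    by (intro mult_left_mono Suc.IH w r)
  finally show ?case by (simp add: w mult.assoc)
qed simp

section \<open>A dimension bound from affinity sums\<close>

lemma emeasure_dist_measure_Icc:
  assumes \<phi>: "increasing_self_map \<phi>" and xy: "0 \<le> x" "x \<le> y" "y \<le> 1"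
  shows "emeasure (dist_measure \<phi>) {x..y} = ennreal (\<phi> y - \<phi> x)"
proof -
  define F where "F = (\<lambda>x. \<phi> (max 0 (min 1 x)))"
  have sm: "strict_mono_on {0..1} \<phi>" and co: "continuous_on {0..1} \<phi>"
    using \<phi> unfolding increasing_self_map_def by blast+
  have mono: "F s \<le> F t" if "s \<le> t" for s t
    unfolding F_def by (rule strict_mono_on_leD[OF sm]) (use that in auto)
  have cont: "continuous_on UNIV F"
    unfolding F_def
    by (rule continuous_on_compose2[OF co]) (intro continuous_intros, auto)
  have "emeasure (dist_measure \<phi>) {x..y} = emeasure (interval_measure F) {x..y}"
    unfolding dist_measure_def F_def[symmetric]
    by (rule emeasure_restrict_space) (use xy in auto)
  also have "\<dots> = ennreal (F y - F x)"
    by (rule emeasure_interval_measure_Icc) (use xy mono cont in auto)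
  finally show ?thesis using xy by (simp add: F_def)
qed

lemma sets_dist_measure: "A \<in> sets borel \<Longrightarrow> A \<subseteq> {0..1} \<Longrightarrow> A \<in> sets (dist_measure \<phi>)"
  by (subst dist_measure_def, subst sets_restrict_space_iff) auto

lemma space_dist_measure [simp]: "space (dist_measure \<phi>) = {0..1}"
  by (auto simp: dist_measure_def space_restrict_space)

text \<open>
  Exponential decay of the sums \<open>\<Sum> sqrt (\<mu>(w) r\<^sub>w\<^sup>s)\<close> over the cylinders of level \<open>k n\<close> forces
  \<open>\<mu>\<close> onto cylinders with \<open>r\<^sub>w\<^sup>s \<le> \<rho>\<^sup>n \<mu>(w)\<close>, the sets \<open>W n\<close> below. The limsup set \<open>A\<close> of these
  cylinders is the set of full measure that witnesses the bound.
\<close>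

lemma hausdorff_dim_dist_measure_le:
  fixes f :: "nat \<Rightarrow> real \<Rightarrow> real" and r :: "nat \<Rightarrow> real"
  assumes N: "N \<ge> 1" and comp: "compatible_system N f"
    and lip: "\<And>i x y. i < N \<Longrightarrow> x \<in> {0..1} \<Longrightarrow> y \<in> {0..1} \<Longrightarrow> \<bar>f i x - f i y\<bar> \<le> r i * \<bar>x - y\<bar>"
    and r: "\<And>i. i < N \<Longrightarrow> 0 < r i \<and> r i \<le> \<kappa>" and \<kappa>: "\<kappa> < 1"
    and \<phi>: "increasing_self_map \<phi>" "\<phi> 0 = 0" "\<phi> 1 = 1"
    and s: "0 < s" and \<rho>: "0 < \<rho>" "\<rho> < 1" and k: "k \<ge> 1"
    and dec: "\<And>n. (\<Sum>w\<in>words N (k * n). sqrt ((\<phi> (word_map f w 1) - \<phi> (word_map f w 0)) * word_weight r w powr s)) \<le> \<rho> ^ n"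
  shows "hausdorff_dim_measure (dist_measure \<phi>) \<le> ereal s"
proof -
  define p where "p w = \<phi> (word_map f w 1) - \<phi> (word_map f w 0)" for w
  define W where "W n = {w \<in> words N (k * n). word_weight r w powr s \<le> \<rho> ^ n * p w}" for n
  define A where "A = (\<Inter>m. \<Union>n\<in>{m..}. \<Union>w\<in>W n. cylinder f w)"
  let ?M = "dist_measure \<phi>"
  have self: "increasing_self_map (f i)" if "i < N" for i
    using comp that by (auto simp: compatible_system_def)
  have \<kappa>0: "0 \<le> \<kappa>" using r[of 0] N by auto
  have ends: "word_map f w 0 \<in> {0..1} \<and> word_map f w 1 \<in> {0..1} \<and> word_map f w 0 \<le> word_map f w 1
      \<and> p w \<ge> 0" if w: "w \<in> words N n" for w n
  proof -
    note h = increasing_self_mapD[OF increasing_self_map_word_map[of N f, OF self w]]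
    have 1: "word_map f w 0 \<le> word_map f w 1" by (rule h(3)) auto
    have 2: "word_map f w 0 \<in> {0..1}" "word_map f w 1 \<in> {0..1}" using h(1)[of 0] h(1)[of 1] by simp_all
    have "\<phi> (word_map f w 0) \<le> \<phi> (word_map f w 1)"
      by (rule increasing_self_mapD(3)[OF \<phi>(1) 2 1])
    then show ?thesis using 1 2 by (simp add: p_def)
  qed
  have meas: "emeasure ?M (cylinder f w) = ennreal (p w)" if "w \<in> words N n" for w n
    unfolding cylinder_def p_def using ends[OF that] by (intro emeasure_dist_measure_Icc \<phi>) auto
  have cyl01: "cylinder f w \<subseteq> {0..1}" if "w \<in> words N n" for w n
    using ends[OF that] by (auto simp: cylinder_def)
  have cylset: "cylinder f w \<in> sets ?M" if "w \<in> words N n" for w n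
    by (intro sets_dist_measure cyl01[OF that]) (simp add: cylinder_def)
  have diam: "diameter (cylinder f w) \<le> word_weight r w" if w: "w \<in> words N n" for w n
  proof -
    have "\<bar>word_map f w 1 - word_map f w 0\<bar> \<le> word_weight r w * \<bar>1 - 0\<bar>"
      by (rule word_map_lipschitz[of N f, OF self lip _ w]) (use r in \<open>auto simp: less_imp_le\<close>)
    then show ?thesis using ends[OF w] by (auto simp: cylinder_def)
  qed
  have diam0: "0 \<le> diameter (cylinder f w)" for w by (simp add: cylinder_def)
  have Wsub: "w \<in> words N (k * n)" if "w \<in> W n" for w n using that by (simp add: W_def)
  have finW: "finite (W n)" for n by (simp add: W_def)

  have total: "(\<Sum>w\<in>W n. diameter (cylinder f w) powr s) \<le> \<rho> ^ n" for n
  proof -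
    have "diameter (cylinder f w) powr s \<le> \<rho> ^ n * p w" if w: "w \<in> W n" for w
    proof -
      have "diameter (cylinder f w) powr s \<le> word_weight r w powr s"
        using diam0 diam[OF Wsub[OF w]] s by (intro powr_mono2) auto
      then show ?thesis using w by (auto simp: W_def)
    qed
    then have "(\<Sum>w\<in>W n. diameter (cylinder f w) powr s) \<le> \<rho> ^ n * (\<Sum>w\<in>W n. p w)"
      unfolding sum_distrib_left by (rule sum_mono)
    also have "(\<Sum>w\<in>W n. p w) \<le> (\<Sum>w\<in>words N (k * n). p w)"
      by (rule sum_mono2) (use ends in \<open>auto simp: W_def\<close>)
    also have "\<dots> = 1" unfolding p_def using sum_words_increments[OF comp N, of \<phi>] \<phi> by simp
    finally show ?thesis using \<rho> by simp
  qed
  have "hausdorff_measure s A = 0" unfolding A_def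
  proof (rule hausdorff_measure_limsup_eq_0[OF finW _ \<kappa>0 \<kappa>])
    fix n w assume w: "w \<in> W n"
    have "diameter (cylinder f w) \<le> word_weight r w" by (rule diam) (rule Wsub[OF w])
    also have "\<dots> \<le> \<kappa> ^ (k * n)" using word_weight_le_power[of N r \<kappa>] r Wsub[OF w] by (force simp: less_imp_le)
    also have "\<dots> \<le> \<kappa> ^ n" using k \<kappa>0 \<kappa> by (intro power_decreasing) auto
    finally show "diameter (cylinder f w) \<le> \<kappa> ^ n" .
  qed (use \<rho> total in \<open>auto simp: cylinder_def\<close>)
  then have dimA: "hausdorff_dim A \<le> ereal s"
    unfolding hausdorff_dim_def using s by (intro INF_lower) auto

  define B where "B m = (\<Union>n\<in>{m..}. \<Union>w\<in>W n. cylinder f w)" for m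
  have Bset: "B m \<in> sets ?M" for m unfolding B_def
    by (intro sets.countable_UN' sets.finite_UN finW) (auto intro: cylset Wsub)
  have full: "emeasure ?M {0..1} = 1"
    using emeasure_dist_measure_Icc[OF \<phi>(1), of 0 1] \<phi> by simp
  have le1: "emeasure ?M X \<le> 1" for X
    using emeasure_space[of ?M X] full by simp
  have B1: "emeasure ?M (B m) = 1" for m
  proof -
    have "1 \<le> emeasure ?M (B m) + ennreal (sqrt \<rho> ^ n)" if n: "n \<ge> m" for n
    proof -
      define C where "C = words N (k * n) - W n"
      have "{0..1} \<subseteq> B m \<union> (\<Union>w\<in>C. cylinder f w)"
      proof
        fix x :: real assume "x \<in> {0..1}"
        from words_cover[OF comp N this] obtain w t where w: "w \<in> words N (k * n)" "t \<in> {0..1}" "x = word_map f w t" by blast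
        note h = increasing_self_mapD(3)[OF increasing_self_map_word_map[of N f, OF self w(1)]]
        have "x \<in> cylinder f w"
          using w h[of 0 t] h[of t 1] by (simp add: cylinder_def)
        then show "x \<in> B m \<union> (\<Union>w\<in>C. cylinder f w)"
          using w(1) n by (cases "w \<in> W n") (auto simp: B_def C_def)
      qed
      then have "emeasure ?M {0..1} \<le> emeasure ?M (B m \<union> (\<Union>w\<in>C. cylinder f w))"
        by (rule emeasure_mono) (auto intro!: Bset cylset simp: C_def)
      also have "\<dots> \<le> emeasure ?M (B m) + emeasure ?M (\<Union>w\<in>C. cylinder f w)"
        by (rule emeasure_subadditive) (auto intro!: Bset cylset simp: C_def)
      also have "emeasure ?M (\<Union>w\<in>C. cylinder f w) \<le> (\<Sum>w\<in>C. emeasure ?M (cylinder f w))"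
        by (rule emeasure_subadditive_finite) (auto simp: C_def intro: cylset)
      also have "\<dots> = (\<Sum>w\<in>C. ennreal (p w))" by (intro sum.cong meas) (auto simp: C_def)
      also have "\<dots> = ennreal (\<Sum>w\<in>C. p w)" by (rule sum_ennreal) (use ends in \<open>auto simp: C_def\<close>)
      also have "(\<Sum>w\<in>C. p w) \<le> sqrt \<rho> ^ n"
      proof -
        \<comment> \<open>Markov's inequality for the square root of \<open>r\<^sub>w\<^sup>s / (\<rho>\<^sup>n p w)\<close>, which exceeds 1 on \<open>C\<close>\<close>
        have "sqrt \<rho> ^ n * p w \<le> sqrt (p w * word_weight r w powr s)" if w: "w \<in> C" for w
        proof -
          have p0: "0 \<le> p w" using ends w by (auto simp: C_def)
          have "\<rho> ^ n * p w \<le> word_weight r w powr s" using w by (auto simp: C_def W_def)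
          then have "p w * (\<rho> ^ n * p w) \<le> p w * word_weight r w powr s"
            using p0 by (rule mult_left_mono)
          then have "sqrt (\<rho> ^ n * (p w)\<^sup>2) \<le> sqrt (p w * word_weight r w powr s)"
            by (intro real_sqrt_le_mono) (simp add: power2_eq_square mult_ac)
          then show ?thesis using p0 by (simp add: real_sqrt_mult real_sqrt_power)
        qed
        then have "(\<Sum>w\<in>C. sqrt \<rho> ^ n * p w) \<le> (\<Sum>w\<in>C. sqrt (p w * word_weight r w powr s))"
          by (rule sum_mono)
        also have "\<dots> \<le> (\<Sum>w\<in>words N (k * n). sqrt (p w * word_weight r w powr s))"
          by (rule sum_mono2) (use ends in \<open>auto simp: C_def\<close>)
        also have "\<dots> \<le> \<rho> ^ n" using dec[of n] by (simp add: p_def)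
        also have "\<dots> = sqrt \<rho> ^ n * sqrt \<rho> ^ n" using \<rho> by (simp flip: power_mult_distrib)
        finally have "sqrt \<rho> ^ n * (\<Sum>w\<in>C. p w) \<le> sqrt \<rho> ^ n * sqrt \<rho> ^ n"
          by (simp add: sum_distrib_left)
        then show ?thesis using \<rho> by simp
      qed
      finally show ?thesis using full by (simp add: ennreal_leI add_left_mono)
    qed
    moreover have "(\<lambda>n. emeasure ?M (B m) + ennreal (sqrt \<rho> ^ n)) \<longlonglongrightarrow> emeasure ?M (B m) + ennreal 0"
      by (intro tendsto_intros tendsto_ennrealI LIMSEQ_power_zero) (use \<rho> in auto)
    ultimately have "1 \<le> emeasure ?M (B m) + ennreal 0"
      by (intro tendsto_lowerbound[of _ _ sequentially]) (auto simp: eventually_sequentially)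
    with le1[of "B m"] show ?thesis by simp
  qed
  have "decseq B" unfolding decseq_def B_def by (intro allI impI UN_mono) auto
  then have "emeasure ?M A = (INF m. emeasure ?M (B m))"
    unfolding A_def B_def[symmetric]
    by (intro INF_emeasure_decseq[symmetric]) (use Bset B1 in auto)
  then have "emeasure ?M A = 1" by (simp add: B1)
  moreover have "A \<in> sets ?M" unfolding A_def B_def[symmetric] using Bset by auto
  ultimately have "hausdorff_dim_measure ?M \<le> hausdorff_dim A"
    unfolding hausdorff_dim_measure_def by (intro INF_lower) auto
  with dimA show ?thesis by simp
qed


section \<open>Affinity of weight vectors\<close>

lemma affinity_le:
  fixes p r :: "'i \<Rightarrow> real"
  assumes I: "finite I" "j \<in> I" and p: "\<And>i. i \<in> I \<Longrightarrow> 0 \<le> p i" "sum p I = 1"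
    and r: "\<And>i. i \<in> I \<Longrightarrow> 0 \<le> r i" "sum r I \<le> 1 + \<delta>"
  shows "(\<Sum>i\<in>I. sqrt (p i * r i)) \<le> 1 + \<delta> / 2 - (sqrt (p j) - sqrt (r j))\<^sup>2 / 2"
proof -
  have *: "sqrt (p i * r i) = (p i + r i) / 2 - (sqrt (p i) - sqrt (r i))\<^sup>2 / 2" if "i \<in> I" for i
    using p(1)[OF that] r(1)[OF that] by (simp add: power2_diff real_sqrt_mult field_simps)
  have "(\<Sum>i\<in>I. sqrt (p i * r i)) = (sum p I + sum r I) / 2 - (\<Sum>i\<in>I. (sqrt (p i) - sqrt (r i))\<^sup>2 / 2)"
    by (simp add: * sum_subtractf sum.distrib flip: sum_divide_distrib)
  moreover have "(sqrt (p j) - sqrt (r j))\<^sup>2 / 2 \<le> (\<Sum>i\<in>I. (sqrt (p i) - sqrt (r i))\<^sup>2 / 2)"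
    by (rule member_le_sum) (use I in auto)
  ultimately show ?thesis using p(2) r(2) by argo
qed

lemma affinity_le_of_dist:
  fixes p r :: "'i \<Rightarrow> real"
  assumes I: "finite I" "j \<in> I" and p: "\<And>i. i \<in> I \<Longrightarrow> 0 \<le> p i" "sum p I = 1"
    and r: "\<And>i. i \<in> I \<Longrightarrow> 0 \<le> r i" "sum r I \<le> 1 + \<delta>" "r j \<le> 1"
    and t: "0 \<le> t" "t \<le> \<bar>p j - r j\<bar>"
  shows "(\<Sum>i\<in>I. sqrt (p i * r i)) \<le> 1 + \<delta> / 2 - t\<^sup>2 / 8"
proof -
  have pj: "0 \<le> p j" "p j \<le> 1" using member_le_sum[of j I p] I p by auto
  have rj: "0 \<le> r j" "r j \<le> 1" using r I by auto
  have "t \<le> \<bar>sqrt (p j) - sqrt (r j)\<bar> * (sqrt (p j) + sqrt (r j))"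
  proof -
    have "(sqrt (p j) - sqrt (r j)) * (sqrt (p j) + sqrt (r j)) = p j - r j"
      using pj rj by (simp add: algebra_simps)
    then show ?thesis using t(2) pj rj by (metis abs_mult abs_of_nonneg add_nonneg_nonneg real_sqrt_ge_zero)
  qed
  also have "\<dots> \<le> \<bar>sqrt (p j) - sqrt (r j)\<bar> * 2"
    using pj rj real_sqrt_le_1_iff[of "p j"] real_sqrt_le_1_iff[of "r j"] by (intro mult_left_mono) linarith+
  finally have "(t / 2)\<^sup>2 \<le> \<bar>sqrt (p j) - sqrt (r j)\<bar>\<^sup>2"
    using t by (intro power_mono) auto
  then have "t\<^sup>2 / 8 \<le> (sqrt (p j) - sqrt (r j))\<^sup>2 / 2"
    by (simp add: power_divide)
  with affinity_le[OF I p r(1,2)] show ?thesis by linarith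
qed

section \<open>Linear fractional systems\<close>

locale linear_fractional_system =
  fixes N :: nat and a b c :: "nat \<Rightarrow> real"
  assumes N2: "N \<ge> 2" and lf: "lf_system N a b c"
begin

lemma b_0 [simp]: "b 0 = 0" and b_N [simp]: "b N = 1"
  using lf by (auto simp: lf_system_def)

lemma c_gt: "i < N \<Longrightarrow> c i + 1 > 0"
  using lf by (auto simp: lf_system_def)

lemma det_pos: "i < N \<Longrightarrow> 0 < a i - b i * c i"
  using lf by (auto simp: lf_system_def)

lemma det_le: "i < N \<Longrightarrow> a i - b i * c i \<le> 1" "i < N \<Longrightarrow> a i - b i * c i \<le> (c i + 1)\<^sup>2"
  using lf by (auto simp: lf_system_def)

lemma a_plus_b: "i < N \<Longrightarrow> a i + b i = b (Suc i) * (c i + 1)"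
proof -
  assume i: "i < N"
  then have "(a i + b i) / (c i + 1) = b (Suc i)" using lf by (auto simp: lf_system_def)
  then show ?thesis using c_gt[OF i] by (auto simp: field_simps)
qed

lemma det_eq: "i < N \<Longrightarrow> a i - b i * c i = (b (Suc i) - b i) * (c i + 1)"
  using a_plus_b[of i] by (simp add: algebra_simps)

lemma b_less_Suc: "i < N \<Longrightarrow> b i < b (Suc i)"
  using det_pos[of i] c_gt[of i] det_eq[of i] by (simp add: zero_less_mult_iff)

lemma b_less: "i < j \<Longrightarrow> j \<le> N \<Longrightarrow> b i < b j"
proof (induction j)
  case (Suc j)
  then show ?case using b_less_Suc[of j] by (cases "i = j") auto
qed simp

lemma b_nonneg: "i \<le> N \<Longrightarrow> 0 \<le> b i"
  using b_less[of 0 i] by (cases "i = 0") auto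

lemma b_pos: "0 < i \<Longrightarrow> i \<le> N \<Longrightarrow> 0 < b i"
  using b_less[of 0 i] by auto

lemma b_less_1: "i < N \<Longrightarrow> b i < 1"
  using b_less[of i N] by auto

lemma b_le_1: "i \<le> N \<Longrightarrow> b i \<le> 1"
  using b_less_1[of i] by (cases "i = N") auto

lemma den_pos:
  assumes "y > -1" "i \<le> N"
  shows "0 < b i * y + 1"
proof (cases "b i = 0")
  case False
  then have "b i * (-1) < b i * y" using assms b_nonneg[of i] by (intro mult_strict_left_mono) auto
  then show ?thesis using b_le_1[OF assms(2)] by simp
qed simp

text \<open>
  \<open>G\<close> and \<open>H\<close> are the functions \<open>lf_G\<close> and \<open>lf_H\<close> at finite arguments, for \<open>G\<close> without the
  cancellation at the last index; they are used for \<open>y > -1\<close> only, where both forms agree and all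
  denominators are positive.
\<close>

definition G :: "nat \<Rightarrow> real \<Rightarrow> real" where
  "G i y = (b (Suc i) - b i) * (y + 1) / ((b (Suc i) * y + 1) * (b i * y + 1))"

definition H :: "nat \<Rightarrow> real \<Rightarrow> real" where
  "H i y = (a i * y + c i) / (b i * y + 1)"

lemma G_pos: "i < N \<Longrightarrow> y > -1 \<Longrightarrow> 0 < G i y"
  unfolding G_def using den_pos[of y i] den_pos[of y "Suc i"] b_less_Suc[of i]
  by (auto intro!: divide_pos_pos mult_pos_pos)

lemma H_plus_1:
  assumes "i < N" "y > -1"
  shows "H i y + 1 = (c i + 1) * (b (Suc i) * y + 1) / (b i * y + 1)"
proof -
  have "H i y + 1 = ((a i + b i) * y + (c i + 1)) / (b i * y + 1)"
    using den_pos[of y i] assms by (simp add: H_def field_simps)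
  then show ?thesis using a_plus_b[OF assms(1)] by (simp add: algebra_simps)
qed

lemma H_gt: 
  assumes "i < N" "y > -1" shows "H i y > -1"
proof -
  have "0 < H i y + 1"
    unfolding H_plus_1[OF assms] using assms den_pos[of y i] den_pos[of y "Suc i"] c_gt
    by (auto intro!: divide_pos_pos mult_pos_pos)
  then show ?thesis by simp
qed

text \<open>
  The linear fractional map with \<open>0 \<mapsto> 0\<close>, \<open>1 \<mapsto> 1\<close> and pole \<open>- 1 / y\<close>. Up to composition with
  an affine map on the left, the maps of the system are of this form, and the lemma \<open>pole_map_lf_map\<close> below shows that
  composition with the \<open>i\<close>-th map of the system changes the parameter \<open>y\<close> into \<open>H i y\<close> and
  scales by \<open>G i y\<close>.
\<close>

definition pole_map :: "real \<Rightarrow> real \<Rightarrow> real" where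
  "pole_map y x = (y + 1) * x / (x * y + 1)"

lemma pole_map_simps [simp]: "pole_map y 0 = 0" "pole_map 0 x = x" "y > -1 \<Longrightarrow> pole_map y 1 = 1"
  by (simp_all add: pole_map_def add.commute)

lemma pole_map_b_Suc: "i < N \<Longrightarrow> y > -1 \<Longrightarrow> pole_map y (b (Suc i)) - pole_map y (b i) = G i y"
proof -
  assume "i < N" "y > -1"
  then have "b i * y + 1 \<noteq> 0" "b (Suc i) * y + 1 \<noteq> 0" using den_pos[of y i] den_pos[of y "Suc i"] by auto
  then show ?thesis
    unfolding pole_map_def G_def by (simp add: diff_frac_eq) (simp add: algebra_simps)
qed

lemma sum_G: "y > -1 \<Longrightarrow> (\<Sum>i<N. G i y) = 1"
proof -
  assume y: "y > -1"
  have "(\<Sum>i<N. G i y) = (\<Sum>i<N. pole_map y (b (Suc i)) - pole_map y (b i))"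
    by (intro sum.cong) (use y pole_map_b_Suc in auto)
  also have "\<dots> = pole_map y (b N) - pole_map y (b 0)" by (rule sum_lessThan_telescope)
  finally show ?thesis using y by simp
qed

lemma pole_map_lf_map:
  assumes i: "i < N" and y: "y > -1" and x: "x \<in> {0..1}"
  shows "pole_map y (lf_map a b c i x) = pole_map y (b i) + G i y * pole_map (H i y) x"
proof -
  define d d' where "d = b i * y + 1" and "d' = b (Suc i) * y + 1"
  define Q where "Q = (a i * y + c i) * x + d"
  have d: "d > 0" "d' > 0" unfolding d_def d'_def using den_pos[OF y] i by auto
  have cx: "0 < c i * x + 1"
  proof -
    have "0 < x * (c i + 1) + (1 - x)"
      using x c_gt[OF i] by (cases "x = 0") (auto intro!: add_pos_nonneg)
    then show ?thesis by (simp add: algebra_simps)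
  qed
  have Q: "0 < Q"
  proof -
    have "Q = x * ((a i + b i) * y + (c i + 1)) + (1 - x) * d"
      by (simp add: Q_def d_def algebra_simps)
    also have "\<dots> = x * ((c i + 1) * d') + (1 - x) * d"
      by (simp add: a_plus_b[OF i] d'_def algebra_simps)
    also have "\<dots> > 0"
      using x c_gt[OF i] d by (cases "x = 0") (auto intro!: add_pos_nonneg)
    finally show ?thesis .
  qed
  have "pole_map y (lf_map a b c i x) = (y + 1) * (a i * x + b i) / Q"
  proof -
    have "lf_map a b c i x * y + 1 = Q / (c i * x + 1)"
      using cx by (simp add: lf_map_def Q_def d_def field_simps)
    then show ?thesis using cx by (simp add: pole_map_def lf_map_def)
  qed
  also have "\<dots> = (y + 1) * b i / d + (a i - b i * c i) * (y + 1) * x / (d * Q)"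
  proof -
    have "(a i * x + b i) * d = b i * Q + (a i - b i * c i) * x"
      by (simp add: Q_def d_def algebra_simps)
    then have "(y + 1) * (a i * x + b i) * d = (y + 1) * b i * Q + (a i - b i * c i) * (y + 1) * x"
      by algebra
    moreover have "(y + 1) * (a i * x + b i) / Q = (y + 1) * (a i * x + b i) * d / (d * Q)"
      using d by simp
    moreover have "(y + 1) * b i / d = (y + 1) * b i * Q / (d * Q)" using Q by simp
    ultimately show ?thesis by (simp add: add_divide_distrib)
  qed
  also have "(y + 1) * b i / d = pole_map y (b i)" by (simp add: pole_map_def d_def)
  also have "(a i - b i * c i) * (y + 1) * x / (d * Q) = G i y * pole_map (H i y) x"
  proof -
    have "x * H i y + 1 = Q / d" using d by (simp add: H_def Q_def d_def field_simps)
    then have "pole_map (H i y) x = (c i + 1) * d' * x / Q"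
      using d by (simp add: pole_map_def H_plus_1[OF i y] d_def[symmetric] d'_def[symmetric])
    then show ?thesis using d by (simp add: G_def d_def[symmetric] d'_def[symmetric] det_eq[OF i])
  qed
  finally show ?thesis .
qed

text \<open>
  The conditional mass of the word \<open>w\<close> from state \<open>y\<close>: letter \<open>i\<close> is chosen with probability
  \<open>G i y\<close>, and the state moves to \<open>H i y\<close>. The measure itself belongs to the state \<open>0\<close>.
\<close>

primrec cyl_prob :: "nat list \<Rightarrow> real \<Rightarrow> real" where
  "cyl_prob [] y = 1"
| "cyl_prob (i # w) y = G i y * cyl_prob w (H i y)"

lemma cyl_prob_nonneg: "w \<in> words N n \<Longrightarrow> y > -1 \<Longrightarrow> 0 \<le> cyl_prob w y"
proof (induction n arbitrary: w y)
  case (Suc n)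
  then obtain i v where w: "w = i # v" "i < N" "v \<in> words N n" by (auto simp: words_Suc)
  then show ?case using Suc.IH[OF w(3) H_gt] G_pos Suc.prems by (simp add: less_imp_le)
qed simp

text \<open>
  The number \<open>0\<close> is the only fixed point in \<open>[0,1]\<close> of the map with index \<open>0\<close>, and \<open>1\<close> that of
  the map with index \<open>N - 1\<close>.
\<close>

lemma conjugacy_0:
  assumes conj: "conjugacy N (lf_map a b c) f \<phi>" and comp: "compatible_system N f"
  shows "\<phi> 0 = 0"
proof (rule ccontr)
  assume ne: "\<phi> 0 \<noteq> 0"
  define x where "x = \<phi> 0"
  have x: "0 < x" "x \<le> 1"
    using ne conj increasing_self_mapD(1)[of \<phi> 0] by (auto simp: conjugacy_def x_def)
  have "lf_map a b c 0 (\<phi> 0) = \<phi> (f 0 0)" using conj N2 by (auto simp: conjugacy_def)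
  then have "lf_map a b c 0 x = x" using comp by (simp add: x_def compatible_system_def)
  moreover have cx: "c 0 * x + 1 > 0"
  proof -
    have "0 < x * (c 0 + 1) + (1 - x)" using x c_gt[of 0] N2 by (intro add_pos_nonneg) auto
    then show ?thesis by (simp add: algebra_simps)
  qed
  ultimately have "x * a 0 = x * (c 0 * x + 1)" by (simp add: lf_map_def divide_eq_eq mult.commute)
  then have a0: "a 0 = c 0 * x + 1" using x by simp
  moreover have "a 0 < c 0 + 1"
    using a_plus_b[of 0] b_less_1[of 1] c_gt[of 0] N2 by simp
  moreover have "a 0 \<le> 1" using det_le[of 0] N2 by simp
  ultimately have "c 0 * x \<le> 0" "c 0 * (1 - x) > 0" by (simp_all add: right_diff_distrib)
  then show False using x by (simp add: mult_le_0_iff zero_less_mult_iff)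
qed

lemma conjugacy_1:
  assumes conj: "conjugacy N (lf_map a b c) f \<phi>" and comp: "compatible_system N f"
  shows "\<phi> 1 = 1"
proof (rule ccontr)
  assume ne: "\<phi> 1 \<noteq> 1"
  define x i where "x = \<phi> 1" and "i = N - 1"
  have i: "i < N" "Suc i = N" "0 < i" using N2 by (auto simp: i_def)
  have x: "0 \<le> x" "x < 1"
    using ne conj increasing_self_mapD(1)[of \<phi> 1] by (auto simp: conjugacy_def x_def)
  have "lf_map a b c i (\<phi> 1) = \<phi> (f i 1)" using conj i by (auto simp: conjugacy_def)
  then have "lf_map a b c i x = x" using comp by (simp add: x_def i_def compatible_system_def)
  moreover have cx: "c i * x + 1 > 0"
  proof -
    have "0 < x * (c i + 1) + (1 - x)" using x c_gt[of i] i by (intro add_nonneg_pos) auto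
    then show ?thesis by (simp add: algebra_simps)
  qed
  ultimately have eq: "a i * x + b i = x * (c i * x + 1)" by (simp add: lf_map_def divide_eq_eq)
  have ab: "a i = c i + 1 - b i" using a_plus_b[OF i(1)] i by simp
  have "(1 - x) * (c i * x + b i) = a i * x + b i - x * (c i * x + 1)"
    unfolding ab by (simp add: algebra_simps)
  with eq have "(1 - x) * (c i * x + b i) = 0" by simp
  then have 0: "c i * x + b i = 0" using x by simp
  have "(c i + 1) * (1 - b i) \<le> (c i + 1) * (c i + 1)"
    using det_le(2)[OF i(1)] det_eq[OF i(1)] i by (simp add: power2_eq_square mult.commute)
  then have "- b i \<le> c i" using c_gt[OF i(1)] by simp
  then have "- b i * x \<le> c i * x" using x by (intro mult_right_mono) auto
  moreover have "b i * x < b i" using x b_pos[of i] i by simp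
  ultimately show False using 0 by simp
qed

text \<open>At \<open>y = 0\<close> this says that the cylinder of \<open>w\<close> has mass \<open>cyl_prob w 0\<close>.\<close>

lemma conjugacy_cyl_prob:
  assumes conj: "conjugacy N (lf_map a b c) f \<phi>" and comp: "compatible_system N f"
    and "w \<in> words N n" "y > -1"
  shows "pole_map y (\<phi> (word_map f w 1)) - pole_map y (\<phi> (word_map f w 0)) = cyl_prob w y"
  using assms(3,4)
proof (induction n arbitrary: w y)
  case 0
  then show ?case by (simp add: conjugacy_0[OF conj comp] conjugacy_1[OF conj comp])
next
  case (Suc n)
  then obtain i v where w: "w = i # v" "i < N" "v \<in> words N n" by (auto simp: words_Suc)
  have self: "increasing_self_map (f i)" if "i < N" for i
    using comp that by (auto simp: compatible_system_def)
  have \<phi>: "increasing_self_map \<phi>" using conj by (simp add: conjugacy_def)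
  have "increasing_self_map (word_map f v)" by (rule increasing_self_map_word_map[OF self w(3)])
  note v = increasing_self_mapD(1)[OF this]
  have "pole_map y (\<phi> (f i (word_map f v x))) = pole_map y (b i) + G i y * pole_map (H i y) (\<phi> (word_map f v x))"
    if "x \<in> {0..1}" for x
  proof -
    have "\<phi> (f i (word_map f v x)) = lf_map a b c i (\<phi> (word_map f v x))"
      using conj w(2) v[OF that] by (auto simp: conjugacy_def)
    moreover have "\<phi> (word_map f v x) \<in> {0..1}" by (rule increasing_self_mapD(1)[OF \<phi> v[OF that]])
    ultimately show ?thesis using pole_map_lf_map[OF w(2) Suc.prems(2)] by simp
  qed
  from this[of 0] this[of 1] show ?case
    using Suc.IH[OF w(3) H_gt[OF w(2) Suc.prems(2)]] by (simp add: w algebra_simps flip: right_diff_distrib)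
qed

section \<open>Fixed points and the gap\<close>

text \<open>
  For \<open>i \<ge> 1\<close> the fixed points are the roots of \<open>b\<^sub>i y\<^sup>2 + (1 - a\<^sub>i) y - c\<^sub>i\<close>, which is at most \<open>0\<close> at
  \<open>y = -1\<close>; hence only the larger root can exceed \<open>-1\<close>.
\<close>

lemma fixed_point_eq_crit:
  assumes i: "i < N" and y: "y > -1" and fixed: "H i y = y"
  shows "lf_crit a b c i = ereal y"
proof -
  have d: "0 < b i * y + 1" using den_pos[of y i] i y by simp
  have eq: "a i * y + c i = y * (b i * y + 1)" using fixed d by (simp add: H_def field_simps)
  show ?thesis
  proof (cases "i = 0")
    case True
    have "a 0 \<noteq> 1"
    proof
      assume "a 0 = 1"
      then have "c 0 = 0" using eq True by simp
      then show False using a_plus_b[of 0] b_less_1[of 1] N2 \<open>a 0 = 1\<close> by simp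
    qed
    then show ?thesis using eq True by (simp add: lf_crit_def field_simps)
  next
    case False
    then have b: "0 < b i" using b_pos i by simp
    have c: "c i = y * (b i * y + 1) - a i * y" using eq by simp
    have q: "b i - 1 + a i - c i \<le> 0"
    proof -
      have "b i - 1 + a i - c i = - ((c i + 1) * (1 - b (Suc i)))"
        using a_plus_b[OF i] by (simp add: algebra_simps)
      moreover have "0 \<le> (c i + 1) * (1 - b (Suc i))" using c_gt[OF i] b_le_1[of "Suc i"] i by simp
      ultimately show ?thesis by linarith
    qed
    have "(y + 1) * (b i * (y - 1) + 1 - a i) = - (b i - 1 + a i - c i)"
      unfolding c by (simp add: algebra_simps)
    then have "0 \<le> (y + 1) * (b i * (y - 1) + 1 - a i)" using q by linarith
    then have "0 \<le> b i * (y - 1) + 1 - a i" using y by (simp add: zero_le_mult_iff)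
    moreover have "0 \<le> b i * (y + 1)" using b y by simp
    ultimately have nn: "0 \<le> 2 * b i * y + 1 - a i" by (simp add: algebra_simps)
    have "(1 - a i)\<^sup>2 + 4 * b i * c i = (2 * b i * y + 1 - a i)\<^sup>2"
      unfolding c by (simp add: power2_eq_square algebra_simps)
    then have "sqrt ((1 - a i)\<^sup>2 + 4 * b i * c i) = 2 * b i * y + 1 - a i" using nn by simp
    then show ?thesis using False b by (simp add: lf_crit_def)
  qed
qed

text \<open>
  If \<open>y > -1\<close> is a common fixed point, all critical numbers equal \<open>y\<close>, so that \<open>Y\<close> is the
  segment between \<open>0\<close> and \<open>y\<close> and stays in \<open>(-1, \<infinity>)\<close>; there the fixed points are unique.
\<close>

lemma lf_prob_const_of_common_fixed_point:
  assumes y: "y > -1" and fixed: "\<And>i. i < N \<Longrightarrow> H i y = y"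
  shows "lf_prob N a b c ` {..<N} = {\<lambda>j\<in>{..<N}. lf_G N b j (ereal y)}"
proof -
  have crit: "lf_crit a b c i = ereal y" if "i < N" for i
    using fixed_point_eq_crit[OF that y] fixed that by blast
  have a0: "a 0 \<noteq> 1" using crit[of 0] N2 by (auto simp: lf_crit_def)
  have "lf_crit a b c ` {..<N} = {ereal y}"
  proof -
    have "lf_crit a b c ` {..<N} = (\<lambda>_. ereal y) ` {..<N}" by (rule image_cong) (use crit in auto)
    then show ?thesis using N2 by (auto simp: image_constant_conv lessThan_empty_iff)
  qed
  moreover have "{i. i < N \<and> \<not> (i = 0 \<and> a 0 = 1)} = {..<N}" using a0 by auto
  ultimately have Y: "lf_Y N a b c = {min 0 (ereal y)..max 0 (ereal y)}"
    by (simp add: lf_Y_def lf_alpha_def lf_beta_def)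
  have "lf_fix N a b c i = ereal y" if i: "i < N" for i
    unfolding lf_fix_def
  proof (rule the_equality)
    show "ereal y \<in> lf_Y N a b c \<and> lf_H a b c i (ereal y) = ereal y"
      using fixed[OF i] by (simp add: Y lf_H_def H_def)
  next
    fix z assume z: "z \<in> lf_Y N a b c \<and> lf_H a b c i z = z"
    then have z1: "min 0 (ereal y) \<le> z" "z \<le> max 0 (ereal y)" by (auto simp: Y)
    then obtain t where t: "z = ereal t" by (cases z) (auto simp: min_def max_def split: if_splits)
    have "t > -1" using z1(1) y by (auto simp: t min_def split: if_splits)
    moreover have "H i t = t" using z by (simp add: t lf_H_def H_def)
    ultimately show "z = ereal y" using fixed_point_eq_crit[OF i] crit[OF i] t by simp
  qed
  then have "lf_prob N a b c i = (\<lambda>j\<in>{..<N}. lf_G N b j (ereal y))" if "i < N" for i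
    using that by (simp add: lf_prob_def)
  moreover have "0 \<in> {..<N}" using N2 by simp
  ultimately show ?thesis by (fastforce simp: image_def)
qed

lemma G_last: "y > -1 \<Longrightarrow> G (N - 1) y = (1 - b (N - 1)) / (b (N - 1) * y + 1)"
  using N2 by (simp add: G_def add.commute)

text \<open>
  In the coordinate \<open>z = 1 / (B y + 1)\<close> with \<open>B = b\<^bsub>N-1\<^esub>\<close>, the states \<open>y > -1\<close> fill the open
  interval \<open>(0, 1 / (1 - B))\<close>, and \<open>H\<^sub>i\<close> becomes a linear fractional map \<open>T\<^sub>i\<close> that is continuous on
  the closed interval. The end points \<open>z = 0\<close> and \<open>z = 1 / (1 - B)\<close> correspond to \<open>y = \<infinity>\<close> and
  \<open>y = -1\<close>; the first is moved by \<open>T\<^bsub>N-1\<^esub>\<close>, the second by \<open>T\<^sub>0\<close>. So the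
  sum \<open>D\<close> of the displacements \<open>\<bar>T\<^sub>i z - z\<bar>\<close> has no zero on the closed interval and, being
  continuous, a positive minimum.
\<close>

lemma G_gap:
  assumes nofix: "\<And>y. y > -1 \<Longrightarrow> \<exists>i<N. H i y \<noteq> y"
  shows "\<exists>\<eta>>0. \<forall>y>-1. \<exists>i<N. \<eta> \<le> \<bar>G (N - 1) (H i y) - G (N - 1) y\<bar>"
proof -
  define B where "B = b (N - 1)"
  have B: "0 < B" "B < 1" using b_pos[of "N - 1"] b_less_1[of "N - 1"] N2 by (auto simp: B_def)
  define num den where "num i z = b i + (B - b i) * z"
    and "den i z = B * a i + b i + (B * (B * c i + 1) - B * a i - b i) * z" for i and z :: real
  define T where "T i z = num i z / den i z" for i z
  define J where "J = {0..1 / (1 - B)}"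
  have den: "0 < den i z" if i: "i < N" and z: "z \<in> J" for i z
  proof -
    define l where "l = (1 - B) * z"
    have "z * (1 - B) \<le> 1" "0 \<le> z" using z B by (simp_all add: J_def le_divide_eq)
    then have l: "0 \<le> l" "l \<le> 1" using B by (simp_all add: l_def mult.commute)
    have zl: "z = l / (1 - B)" using B by (simp add: l_def)
    have e0: "0 < B * a i + b i"
    proof (cases "i = 0")
      case True
      then show ?thesis using det_pos[of 0] N2 B by simp
    next
      case False
      then have bi: "0 < b i" using b_pos i by simp
      have "- b i \<le> b i * c i" using bi c_gt[OF i] mult_left_mono[of "-1" "c i" "b i"] by simp
      then have "- b i < a i" using det_pos[OF i] by linarith
      then have "B * (- b i) < B * a i" using B by (intro mult_strict_left_mono)
      moreover have "B * b i < b i" using B bi by simp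
      ultimately show ?thesis by simp
    qed
    have e1: "0 < B * (1 - b i - B * (a i - c i)) / (1 - B)"
    proof -
      have "b (Suc i) * (c i + 1) \<le> 1 * (c i + 1)"
        using b_le_1[of "Suc i"] c_gt[OF i] i by (intro mult_right_mono) auto
      then have "a i - c i \<le> 1 - b i" unfolding a_plus_b[OF i, symmetric] by simp
      then have "B * (a i - c i) \<le> B * (1 - b i)" using B by (intro mult_left_mono) auto
      also have "\<dots> < 1 - b i" using B b_less_1[OF i] by simp
      finally show ?thesis using B by simp
    qed
    \<comment> \<open>\<open>den i\<close> is affine, so positivity at the two end points suffices\<close>
    have "den i z = (1 - l) * (B * a i + b i) + l * (B * (1 - b i - B * (a i - c i)) / (1 - B))"
      unfolding den_def zl using B by (simp add: field_simps)
    also have "\<dots> > 0"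
    proof (cases "l = 0")
      case False
      show ?thesis by (rule add_nonneg_pos[OF _ mult_pos_pos[OF _ e1]]) (use False l e0 in auto)
    qed (use e0 in simp)
    finally show ?thesis .
  qed
  have T_coord: "T i (1 / (B * y + 1)) = 1 / (B * H i y + 1)" if i: "i < N" and y: "y > -1" for i y
  proof -
    have p: "0 < B * y + 1" unfolding B_def using den_pos[of y "N - 1"] y by simp
    have p': "0 < B * H i y + 1" unfolding B_def using den_pos[of "H i y" "N - 1"] H_gt[OF i y] by simp
    have d: "0 < b i * y + 1" using den_pos[of y i] y i by simp
    have n1: "num i (1 / (B * y + 1)) = B * (b i * y + 1) / (B * y + 1)"
      using p by (simp add: num_def field_simps)
    have "den i (1 / (B * y + 1)) = B * (B * (a i * y + c i) + (b i * y + 1)) / (B * y + 1)"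
      using p by (simp add: den_def field_simps)
    also have "a i * y + c i = H i y * (b i * y + 1)" using d by (simp add: H_def)
    also have "B * (B * (H i y * (b i * y + 1)) + (b i * y + 1)) = B * (b i * y + 1) * (B * H i y + 1)"
      by (simp add: algebra_simps)
    finally show ?thesis using n1 p d B p' by (simp add: T_def)
  qed
  define D where "D z = (\<Sum>i<N. \<bar>T i z - z\<bar>)" for z
  have "continuous_on J D"
    unfolding D_def T_def
    by (intro continuous_intros) (use den in \<open>force simp: num_def den_def intro!: continuous_intros\<close>)+
  moreover have "compact J" "J \<noteq> {}" using B by (auto simp: J_def)
  ultimately obtain z0 where z0: "z0 \<in> J" and min: "\<And>z. z \<in> J \<Longrightarrow> D z0 \<le> D z"
    using continuous_attains_inf[of J D] by blast
  have "D z0 > 0"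
  proof (rule ccontr)
    assume "\<not> D z0 > 0"
    moreover have "D z0 \<ge> 0" by (auto simp: D_def intro: sum_nonneg)
    ultimately have "D z0 = 0" by simp
    then have T0: "T i z0 = z0" if "i < N" for i
      using that by (auto simp: D_def sum_nonneg_eq_0_iff)
    consider "z0 = 0" | "z0 = 1 / (1 - B)" | "0 < z0" "z0 < 1 / (1 - B)"
      using z0 unfolding J_def atLeastAtMost_iff by linarith
    then show False
    proof cases
      case 1
      then show ?thesis using T0[of "N - 1"] den[of "N - 1" 0] z0 N2 B by (simp add: T_def num_def B_def)
    next
      case 2
      have "num 0 z0 = z0 * den 0 z0" using T0[of 0] den[OF _ z0, of 0] N2 by (auto simp: T_def field_simps)
      then have "B * z0 = z0 * den 0 z0" by (simp add: num_def)
      then have "B = den 0 z0" using 2 B by simp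
      then have "B * (1 - B) = B * a 0 * (1 - B) + (B * (B * c 0 + 1) - B * a 0)"
        using B by (simp add: den_def 2 field_simps)
      then have "B * B * (a 0 - (c 0 + 1)) = 0" by (simp add: algebra_simps)
      then have "a 0 = c 0 + 1" using B by simp
      then show ?thesis using a_plus_b[of 0] b_less_1[of 1] c_gt[of 0] N2 by simp
    next
      case 3
      define y where "y = (1 - z0) / (B * z0)"
      have By: "B * y + 1 = 1 / z0" using B 3 by (simp add: y_def field_simps)
      have "1 - B < 1 / z0" using 3 B by (simp add: field_simps)
      then have "B * (-1) < B * y" using By by linarith
      then have y: "y > -1" using B by (simp only: mult_less_cancel_left_pos)
      obtain i where i: "i < N" "H i y \<noteq> y" using nofix[OF y] by blast
      have z0y: "z0 = 1 / (B * y + 1)" using By by simp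
      have "T i z0 = 1 / (B * H i y + 1)" unfolding z0y by (rule T_coord[OF i(1) y])
      then have "1 / (B * H i y + 1) = 1 / (B * y + 1)" using T0[OF i(1)] z0y by metis
      then have "B * H i y = B * y" by simp
      then have "H i y = y" using B by auto
      then show ?thesis using i(2) by blast
    qed
  qed
  define \<eta> where "\<eta> = (1 - B) * (D z0 / N)"
  have "\<exists>i<N. \<eta> \<le> \<bar>G (N - 1) (H i y) - G (N - 1) y\<bar>" if y: "y > -1" for y
  proof -
    define z where "z = 1 / (B * y + 1)"
    have p: "0 < B * y + 1" unfolding B_def using den_pos[of y "N - 1"] y by simp
    have "B * (-1) \<le> B * y" using B y by (intro mult_left_mono) auto
    then have "1 - B \<le> B * y + 1" by simp
    then have z: "z \<in> J" using B p by (simp add: J_def z_def frac_le)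
    have "\<exists>i<N. D z0 / N \<le> \<bar>T i z - z\<bar>"
    proof (rule ccontr)
      assume "\<not> (\<exists>i<N. D z0 / N \<le> \<bar>T i z - z\<bar>)"
      then have "\<And>i. i \<in> {..<N} \<Longrightarrow> \<bar>T i z - z\<bar> < D z0 / N" by auto
      then have "D z < (\<Sum>i<N. D z0 / N)" unfolding D_def[of z]
        by (intro sum_strict_mono) (use N2 in \<open>auto simp: lessThan_empty_iff\<close>)
      also have "\<dots> = D z0" using N2 by simp
      finally show False using min[OF z] by simp
    qed
    then obtain i where i: "i < N" "D z0 / N \<le> \<bar>T i z - z\<bar>" by blast
    have "G (N - 1) (H i y) - G (N - 1) y = (1 - B) * (T i z - z)"
      using T_coord[OF i(1) y] G_last[OF y] G_last[OF H_gt[OF i(1) y]]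
      by (simp add: z_def B_def right_diff_distrib)
    then have "\<bar>G (N - 1) (H i y) - G (N - 1) y\<bar> = (1 - B) * \<bar>T i z - z\<bar>" using B by (simp add: abs_mult)
    moreover have "\<eta> \<le> (1 - B) * \<bar>T i z - z\<bar>"
      unfolding \<eta>_def using i(2) B by (intro mult_left_mono) auto
    ultimately show ?thesis using i(1) by metis
  qed
  moreover have "\<eta> > 0" using B N2 \<open>D z0 > 0\<close> by (simp add: \<eta>_def)
  ultimately show ?thesis by blast
qed

text \<open>
  Let \<open>i\<close> be an index for which the last weight changes by at least \<open>\<eta>\<close> between \<open>y\<close> and \<open>H i y\<close>.
  Then \<open>G y\<close> or \<open>G (H i y)\<close> differs from \<open>r\<close> by \<open>\<eta> / 2\<close>. In the latter case the deficit is
  multiplied by the weight of the letter \<open>i\<close>; that weight is bounded below unless \<open>G i y\<close> is far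
  from \<open>r i \<ge> \<epsilon>\<close>, which is a deficit in the first step again.
\<close>

lemma two_step_affinity_gap:
  assumes nofix: "\<And>y. y > -1 \<Longrightarrow> \<exists>i<N. H i y \<noteq> y" and \<epsilon>: "0 < \<epsilon>" "\<epsilon> < 1"
  shows "\<exists>\<kappa>>0. \<kappa> \<le> 1 \<and> (\<forall>\<delta> r y. 0 \<le> \<delta> \<and> (\<forall>i<N. \<epsilon> \<le> r i \<and> r i \<le> 1) \<and> (\<Sum>i<N. r i) \<le> 1 + \<delta> \<and> y > -1 \<longrightarrow>
    (\<Sum>i<N. sqrt (G i y * r i) * (\<Sum>j<N. sqrt (G j (H i y) * r j))) \<le> (1 + \<delta> / 2)\<^sup>2 - \<kappa>)"
proof -
  obtain \<eta> where \<eta>: "\<eta> > 0" and gap: "\<And>y. y > -1 \<Longrightarrow> \<exists>i<N. \<eta> \<le> \<bar>G (N - 1) (H i y) - G (N - 1) y\<bar>"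
    using G_gap[OF nofix] by blast
  define \<kappa>1 where "\<kappa>1 = (\<eta> / 2)\<^sup>2 / 8"
  define \<kappa>2 where "\<kappa>2 = (\<epsilon> / 2)\<^sup>2 / 8"
  define \<kappa> where "\<kappa> = min (\<kappa>1 * (\<epsilon> / 2)) \<kappa>2"
  have k1: "0 < \<kappa>1" "0 < \<kappa>2" using \<eta> \<epsilon> by (auto simp: \<kappa>1_def \<kappa>2_def)
  have k2: "\<kappa>2 \<le> 1" using \<epsilon> power_le_one[of "\<epsilon> / 2" 2] by (simp add: \<kappa>2_def)
  have \<kappa>: "0 < \<kappa>" "\<kappa> \<le> 1" "\<kappa> \<le> \<kappa>1 * (\<epsilon> / 2)" "\<kappa> \<le> \<kappa>2" using k1 k2 \<epsilon> by (auto simp: \<kappa>_def)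
  have \<kappa>': "\<kappa> \<le> \<kappa>1" using \<kappa>(3) k1 \<epsilon> mult_left_mono[of "\<epsilon> / 2" 1 \<kappa>1] by linarith
  have "(\<Sum>i<N. sqrt (G i y * r i) * (\<Sum>j<N. sqrt (G j (H i y) * r j))) \<le> (1 + \<delta> / 2)\<^sup>2 - \<kappa>"
    if \<delta>: "0 \<le> \<delta>" and r: "\<And>i. i < N \<Longrightarrow> \<epsilon> \<le> r i \<and> r i \<le> 1" and rs: "(\<Sum>i<N. r i) \<le> 1 + \<delta>" and y: "y > -1" for \<delta> r y
  proof -
    define L where "L = 1 + \<delta> / 2"
    define \<beta> where "\<beta> u = (\<Sum>j<N. sqrt (G j u * r j))" for u
    have r0: "0 \<le> r i" if "i < N" for i using r[OF that] \<epsilon> by simp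
    have far: "\<beta> u \<le> L - t\<^sup>2 / 8" if "u > -1" "j < N" "0 \<le> t" "t \<le> \<bar>G j u - r j\<bar>" for u t j
      unfolding \<beta>_def L_def
      by (rule affinity_le_of_dist[of _ j]) (use that r r0 rs G_pos sum_G in \<open>auto simp: less_imp_le\<close>)
    have \<beta>L: "\<beta> u \<le> L" if "u > -1" for u using far[OF that, of 0 0] N2 by simp
    have \<beta>0: "0 \<le> \<beta> u" if "u > -1" for u unfolding \<beta>_def
      using that r0 G_pos by (intro sum_nonneg) (auto simp: less_imp_le)
    have L1: "1 \<le> L" using \<delta> by (simp add: L_def)
    have step: "(\<Sum>i<N. sqrt (G i y * r i) * \<beta> (H i y)) \<le> \<beta> y * L"
      unfolding \<beta>_def[of y] sum_distrib_right
      by (intro sum_mono mult_left_mono \<beta>L H_gt y) (use r0 G_pos y in \<open>auto simp: less_imp_le\<close>)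
    have LL: "(L - k) * L \<le> L\<^sup>2 - \<kappa>" if "\<kappa> \<le> k" for k
    proof -
      have "k * 1 \<le> k * L" using L1 that \<kappa> by (intro mult_left_mono) auto
      then show ?thesis using that by (simp add: algebra_simps power2_eq_square)
    qed
    have one: "(\<Sum>i<N. sqrt (G i y * r i) * \<beta> (H i y)) \<le> L\<^sup>2 - \<kappa>" if "\<beta> y \<le> L - k" "\<kappa> \<le> k" for k
    proof -
      have "\<beta> y * L \<le> (L - k) * L" using that L1 by (intro mult_right_mono) auto
      then show ?thesis using step LL[OF that(2)] by linarith
    qed
    have "(\<Sum>i<N. sqrt (G i y * r i) * \<beta> (H i y)) \<le> L\<^sup>2 - \<kappa>"
    proof -
      obtain i where i: "i < N" "\<eta> \<le> \<bar>G (N - 1) (H i y) - G (N - 1) y\<bar>" using gap[OF y] by blast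
      then consider "\<eta> / 2 \<le> \<bar>G (N - 1) y - r (N - 1)\<bar>" | "G i y \<le> \<epsilon> / 4"
        | "\<eta> / 2 \<le> \<bar>G (N - 1) (H i y) - r (N - 1)\<bar>" "\<epsilon> / 4 \<le> G i y"
        by linarith
      then show ?thesis
      proof cases
        case 1
        show ?thesis by (rule one[OF _ \<kappa>']) (use far[OF y _ _ 1] N2 \<eta> in \<open>simp add: \<kappa>1_def\<close>)
      next
        case 2
        then have "\<epsilon> / 2 \<le> \<bar>G i y - r i\<bar>" using r[OF i(1)] by linarith
        then show ?thesis by (intro one[OF _ \<kappa>(4)]) (use far[OF y i(1), of "\<epsilon> / 2"] \<epsilon> in \<open>simp add: \<kappa>2_def\<close>)
      next
        case 3
        have "\<beta> (H i y) \<le> L - \<kappa>1"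
          unfolding \<kappa>1_def by (rule far[OF H_gt[OF i(1) y] _ _ 3(1)]) (use N2 \<eta> in auto)
        then have bi: "sqrt (G i y * r i) * \<beta> (H i y) \<le> sqrt (G i y * r i) * (L - \<kappa>1)"
          using r0[OF i(1)] G_pos[OF i(1) y] by (intro mult_left_mono) auto
        have "(\<epsilon> / 4) * \<epsilon> \<le> G i y * r i" using 3(2) r[OF i(1)] \<epsilon> by (intro mult_mono) auto
        then have "sqrt ((\<epsilon> / 2)\<^sup>2) \<le> sqrt (G i y * r i)"
          by (intro real_sqrt_le_mono) (simp add: power2_eq_square)
        then have "\<epsilon> / 2 \<le> sqrt (G i y * r i)" using \<epsilon> by simp
        then have "\<kappa>1 * (\<epsilon> / 2) \<le> \<kappa>1 * sqrt (G i y * r i)" using k1 by (intro mult_left_mono) auto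
        then have k: "\<kappa> \<le> \<kappa>1 * sqrt (G i y * r i)" using \<kappa>(3) by linarith
        have "(\<Sum>j<N. sqrt (G j y * r j) * \<beta> (H j y)) 
            = sqrt (G i y * r i) * \<beta> (H i y) + (\<Sum>j\<in>{..<N} - {i}. sqrt (G j y * r j) * \<beta> (H j y))"
          using i by (subst sum.remove[of _ i]) auto
        also have "\<dots> \<le> sqrt (G i y * r i) * (L - \<kappa>1) + (\<Sum>j\<in>{..<N} - {i}. sqrt (G j y * r j) * L)"
          by (intro add_mono bi sum_mono mult_left_mono \<beta>L H_gt y) (use r0 G_pos y in \<open>auto simp: less_imp_le\<close>)
        also have "\<dots> = (sqrt (G i y * r i) * L + (\<Sum>j\<in>{..<N} - {i}. sqrt (G j y * r j) * L)) - \<kappa>1 * sqrt (G i y * r i)"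
          by (simp add: algebra_simps)
        also have "sqrt (G i y * r i) * L + (\<Sum>j\<in>{..<N} - {i}. sqrt (G j y * r j) * L) = \<beta> y * L"
          unfolding \<beta>_def sum_distrib_right using i by (subst sum.remove[of "{..<N}" i]) auto
        also have "\<beta> y * L - \<kappa>1 * sqrt (G i y * r i) \<le> L * L - \<kappa>"
          using k \<beta>L[OF y] L1 by (intro diff_mono mult_right_mono) auto
        finally show ?thesis by (simp add: power2_eq_square)
      qed
    qed
    then show ?thesis by (simp add: \<beta>_def L_def)
  qed
  then show ?thesis using \<kappa> by (intro exI[of _ \<kappa>]) auto
qed

section \<open>Decay of the affinity sums\<close>

text \<open>
  The affinity (Bhattacharyya coefficient) of the masses and the weights \<open>r\<^sub>w\<^sup>s\<close> of the words of
  length \<open>n\<close>, started from the state \<open>y\<close>.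
\<close>

definition affinity_sum :: "(nat \<Rightarrow> real) \<Rightarrow> real \<Rightarrow> nat \<Rightarrow> real \<Rightarrow> real" where
  "affinity_sum r s n y = (\<Sum>w\<in>words N n. sqrt (cyl_prob w y * word_weight r w powr s))"

lemma affinity_sum_Suc:
  assumes r: "\<And>i. i < N \<Longrightarrow> 0 < r i"
  shows "affinity_sum r s (Suc n) y = (\<Sum>i<N. sqrt (G i y * r i powr s) * affinity_sum r s n (H i y))"
proof -
  have "sqrt (cyl_prob (i # w) y * word_weight r (i # w) powr s)
      = sqrt (G i y * r i powr s) * sqrt (cyl_prob w (H i y) * word_weight r w powr s)"
    if "i < N" "w \<in> words N n" for i w
    using r[OF that(1)] word_weight_pos[of N r, OF r that(2)]
    by (simp add: powr_mult mult_ac flip: real_sqrt_mult)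
  then show ?thesis
    unfolding affinity_sum_def sum_words_Suc sum_distrib_left by (intro sum.cong) auto
qed

lemma affinity_sum_le_power:
  assumes \<epsilon>: "0 < \<epsilon>" and r: "\<And>i. i < N \<Longrightarrow> \<epsilon> \<le> r i" and s: "s \<le> 1"
    and two: "\<And>y. y > -1 \<Longrightarrow> (\<Sum>i<N. sqrt (G i y * r i) * (\<Sum>j<N. sqrt (G j (H i y) * r j))) \<le> \<theta>"
    and y: "y > -1"
  shows "affinity_sum r s (2 * n) y \<le> (\<epsilon> powr (s - 1) * \<theta>) ^ n"
  using y
proof (induction n arbitrary: y)
  case 0
  then show ?case by (simp add: affinity_sum_def)
next
  case (Suc n)
  define E where "E = \<epsilon> powr (s - 1)"
  define \<rho> where "\<rho> = E * \<theta>"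
  have E: "0 < E" using \<epsilon> by (simp add: E_def)
  have r0: "0 < r i" if "i < N" for i using r[OF that] \<epsilon> by simp
  have S_Suc: "affinity_sum r s (Suc m) u = (\<Sum>i<N. sqrt (G i u * r i powr s) * affinity_sum r s m (H i u))" for m u
    by (rule affinity_sum_Suc[OF r0])
  have one: "sqrt (G i u * r i powr s) \<le> sqrt E * sqrt (G i u * r i)" if i: "i < N" and u: "u > -1" for i u
  proof -
    have "r i powr s = r i * r i powr (s - 1)" using r0[OF i] by (simp add: powr_diff)
    also have "\<dots> \<le> r i * E"
      unfolding E_def using r[OF i] r0[OF i] s \<epsilon> by (intro mult_left_mono powr_mono2') auto
    finally have "G i u * r i powr s \<le> G i u * (r i * E)" using G_pos[OF i u] by (intro mult_left_mono) auto
    then show ?thesis by (simp add: mult_ac flip: real_sqrt_mult)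
  qed
  have IH: "affinity_sum r s (2 * n) u \<le> \<rho> ^ n" if "u > -1" for u
    using Suc.IH[OF that] by (simp add: \<rho>_def E_def)
  have nn: "0 \<le> affinity_sum r s m u" if "u > -1" for u m
    unfolding affinity_sum_def using that by (intro sum_nonneg) (auto intro!: mult_nonneg_nonneg cyl_prob_nonneg)
  have \<rho>n: "0 \<le> \<rho> ^ n" using nn[of 0 "2 * n"] IH[of 0] by linarith
  have S1: "affinity_sum r s (Suc (2 * n)) u \<le> sqrt E * (\<Sum>j<N. sqrt (G j u * r j)) * \<rho> ^ n" if u: "u > -1" for u
  proof -
    have "affinity_sum r s (Suc (2 * n)) u \<le> (\<Sum>j<N. (sqrt E * sqrt (G j u * r j)) * \<rho> ^ n)"
      unfolding S_Suc
      by (intro sum_mono mult_mono one IH H_gt u nn) (use E G_pos r0 u in \<open>auto simp: less_imp_le\<close>)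
    then show ?thesis by (simp add: sum_distrib_left sum_distrib_right)
  qed
  have "affinity_sum r s (Suc (Suc (2 * n))) y
      \<le> (\<Sum>i<N. (sqrt E * sqrt (G i y * r i)) * (sqrt E * (\<Sum>j<N. sqrt (G j (H i y) * r j)) * \<rho> ^ n))"
    unfolding S_Suc[of "Suc (2 * n)"]
    by (intro sum_mono mult_mono one S1 H_gt Suc.prems nn) (use E G_pos r0 Suc.prems in \<open>auto simp: less_imp_le\<close>)
  also have "\<dots> = (E * (\<Sum>i<N. sqrt (G i y * r i) * (\<Sum>j<N. sqrt (G j (H i y) * r j)))) * \<rho> ^ n"
  proof -
    have "(sqrt E * p) * (sqrt E * q * t) = E * (p * q) * t" for p q t :: real
    proof -
      have "(sqrt E * p) * (sqrt E * q * t) = (sqrt E * sqrt E) * (p * q) * t" by (simp only: mult_ac)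
      then show ?thesis using E by simp
    qed
    then show ?thesis by (simp only: flip: sum_distrib_left sum_distrib_right)
  qed
  also have "\<dots> \<le> (E * \<theta>) * \<rho> ^ n"
    using E \<rho>n two[OF Suc.prems] by (intro mult_right_mono mult_left_mono) auto
  finally show ?case by (simp add: \<rho>_def E_def)
qed

end

section \<open>The dimension drop\<close>

lemma lip_norm_bound:
  assumes "lip_norm h = ereal L" "x \<in> {0..1}" "y \<in> {0..1}"
  shows "\<bar>h x - h y\<bar> \<le> L * \<bar>x - y\<bar>"
proof (cases "x = y")
  case False
  have "ereal (\<bar>h x - h y\<bar> / \<bar>x - y\<bar>) \<le> lip_norm h"
    unfolding lip_norm_def by (rule SUP_upper2[of "(x, y)"]) (use assms False in auto)
  then show ?thesis using assms(1) False by (simp add: divide_le_eq)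
qed simp

theorem theorem3p2:
  fixes N :: nat and a b c :: "nat \<Rightarrow> real"
  assumes "N \<ge> 2"
    and "lf_system N a b c"
    and "card (lf_prob N a b c ` {..<N}) \<ge> 2"
  shows "\<forall>\<epsilon>::real. 0 < \<epsilon> \<and> \<epsilon> < 1 / 2 \<longrightarrow>
    (\<exists>\<delta>::real. \<delta> > 0 \<and>
      (\<forall>f :: nat \<Rightarrow> real \<Rightarrow> real.
        contractive_system N f \<and>
        (\<Sum>i<N. lip_norm (f i)) < ereal (1 + \<delta>) \<and>
        (\<forall>i<N. ereal \<epsilon> \<le> lip_norm (f i) \<and> lip_norm (f i) \<le> ereal (1 - \<epsilon>))
        \<longrightarrow> (\<forall>\<phi> :: real \<Rightarrow> real.
              conjugacy N (lf_map a b c) f \<phi> \<longrightarrow>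
              hausdorff_dim_measure (dist_measure \<phi>) < 1)))"
proof (intro allI impI)
  fix \<epsilon> :: real assume "0 < \<epsilon> \<and> \<epsilon> < 1 / 2"
  then have \<epsilon>: "0 < \<epsilon>" "\<epsilon> < 1" by auto
  interpret linear_fractional_system N a b c using assms by unfold_locales
  have nofix: "\<exists>i<N. H i y \<noteq> y" if "y > -1" for y
  proof (rule ccontr)
    assume "\<not> (\<exists>i<N. H i y \<noteq> y)"
    then have "card (lf_prob N a b c ` {..<N}) = 1"
      using lf_prob_const_of_common_fixed_point[OF that] by simp
    then show False using assms(3) by simp
  qed
  obtain \<kappa> where \<kappa>: "0 < \<kappa>" "\<kappa> \<le> 1" and gap:
    "\<And>\<delta> r y. 0 \<le> \<delta> \<Longrightarrow> (\<And>i. i < N \<Longrightarrow> \<epsilon> \<le> r i \<and> r i \<le> 1) \<Longrightarrow> (\<Sum>i<N. r i) \<le> 1 + \<delta> \<Longrightarrow> y > -1 \<Longrightarrow>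
      (\<Sum>i<N. sqrt (G i y * r i) * (\<Sum>j<N. sqrt (G j (H i y) * r j))) \<le> (1 + \<delta> / 2)\<^sup>2 - \<kappa>"
    using two_step_affinity_gap[OF nofix \<epsilon>] by blast
  define \<delta> where "\<delta> = \<kappa> / 4"
  \<comment> \<open>\<open>s\<close> is chosen such that \<open>E \<le> 1 + \<kappa> / 2\<close>, whence \<open>\<rho> \<le> 1 - \<kappa>\<^sup>2 / 4\<close>\<close>
  define s where "s = max (1 / 2) (1 + log \<epsilon> (1 + \<kappa> / 2))"
  define E where "E = \<epsilon> powr (s - 1)"
  define \<rho> where "\<rho> = E * (1 - \<kappa> / 2)"
  have "(1 + \<delta> / 2)\<^sup>2 - \<kappa> = 1 - 3 / 4 * \<kappa> + \<kappa> * \<kappa> / 64"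
    by (simp add: \<delta>_def power2_eq_square algebra_simps)
  moreover have "\<kappa> * \<kappa> \<le> \<kappa> * 1" using \<kappa> by (intro mult_left_mono) auto
  ultimately have \<theta>: "(1 + \<delta> / 2)\<^sup>2 - \<kappa> \<le> 1 - \<kappa> / 2" using \<kappa> by linarith
  have "log \<epsilon> (1 + \<kappa> / 2) < 0" using \<epsilon> \<kappa> by (simp add: log_def divide_pos_neg)
  then have s: "0 < s" "s < 1" by (auto simp: s_def)
  have "E \<le> \<epsilon> powr log \<epsilon> (1 + \<kappa> / 2)"
    unfolding E_def using \<epsilon> by (intro powr_mono') (auto simp: s_def)
  also have "\<dots> = 1 + \<kappa> / 2" using \<epsilon> \<kappa> by simp
  finally have "\<rho> \<le> (1 + \<kappa> / 2) * (1 - \<kappa> / 2)" unfolding \<rho>_def using \<kappa> by (intro mult_right_mono) auto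
  also have "\<dots> = 1 - (\<kappa> / 2)\<^sup>2" by (simp add: power2_eq_square algebra_simps)
  also have "\<dots> < 1" using \<kappa> by simp
  finally have \<rho>1: "\<rho> < 1" .
  have \<rho>0: "0 < \<rho>" unfolding \<rho>_def E_def using \<epsilon> \<kappa> by simp
  have "hausdorff_dim_measure (dist_measure \<phi>) < 1"
    if f: "contractive_system N f" and sum: "(\<Sum>i<N. lip_norm (f i)) < ereal (1 + \<delta>)"
      and bounds: "\<forall>i<N. ereal \<epsilon> \<le> lip_norm (f i) \<and> lip_norm (f i) \<le> ereal (1 - \<epsilon>)"
      and conj: "conjugacy N (lf_map a b c) f \<phi>" for f \<phi>
  proof -
    define r where "r i = real_of_ereal (lip_norm (f i))" for i
    have lip: "lip_norm (f i) = ereal (r i)" and r: "\<epsilon> \<le> r i" "r i \<le> 1 - \<epsilon>" if "i < N" for i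
      using bounds[rule_format, OF that] unfolding r_def by (cases "lip_norm (f i)"; simp)+
    have "(\<Sum>i<N. lip_norm (f i)) = ereal (\<Sum>i<N. r i)" using lip by simp
    then have rsum: "(\<Sum>i<N. r i) \<le> 1 + \<delta>" using sum by simp
    have comp: "compatible_system N f" using f by (simp add: contractive_system_def)
    have two: "(\<Sum>i<N. sqrt (G i y * r i) * (\<Sum>j<N. sqrt (G j (H i y) * r j))) \<le> 1 - \<kappa> / 2" if "y > -1" for y
      using gap[of \<delta> r y] r rsum that \<theta> \<epsilon> \<kappa> by (fastforce simp: \<delta>_def)
    have decay: "(\<Sum>w\<in>words N (2 * n). sqrt ((\<phi> (word_map f w 1) - \<phi> (word_map f w 0)) * word_weight r w powr s)) \<le> \<rho> ^ n" for n
    proof -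
      have "(\<Sum>w\<in>words N (2 * n). sqrt ((\<phi> (word_map f w 1) - \<phi> (word_map f w 0)) * word_weight r w powr s))
          = affinity_sum r s (2 * n) 0"
        unfolding affinity_sum_def
        by (intro sum.cong refl) (use conjugacy_cyl_prob[OF conj comp, of _ "2 * n" 0] in simp)
      also have "\<dots> \<le> \<rho> ^ n"
        unfolding \<rho>_def E_def by (rule affinity_sum_le_power) (use \<epsilon> r s two in auto)
      finally show ?thesis .
    qed
    have "hausdorff_dim_measure (dist_measure \<phi>) \<le> ereal s"
    proof (rule hausdorff_dim_dist_measure_le[where f = f and r = r and \<kappa> = "1 - \<epsilon>" and k = 2 and \<rho> = \<rho>])
      show "increasing_self_map \<phi>" using conj by (simp add: conjugacy_def)
      show "\<bar>f i x - f i y\<bar> \<le> r i * \<bar>x - y\<bar>" if "i < N" "x \<in> {0..1}" "y \<in> {0..1}" for i x y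
        using lip_norm_bound[OF lip] that by blast
      show "0 < r i \<and> r i \<le> 1 - \<epsilon>" if "i < N" for i using r[OF that] \<epsilon> by linarith
    qed (use N2 comp \<epsilon> conjugacy_0[OF conj comp] conjugacy_1[OF conj comp] s \<rho>0 \<rho>1 decay in auto)
    also have "ereal s < 1" using s by simp
    finally show ?thesis .
  qed
  then show "\<exists>\<delta>>0. \<forall>f. contractive_system N f \<and> (\<Sum>i<N. lip_norm (f i)) < ereal (1 + \<delta>) \<and>
        (\<forall>i<N. ereal \<epsilon> \<le> lip_norm (f i) \<and> lip_norm (f i) \<le> ereal (1 - \<epsilon>))
        \<longrightarrow> (\<forall>\<phi>. conjugacy N (lf_map a b c) f \<phi> \<longrightarrow> hausdorff_dim_measure (dist_measure \<phi>) < 1)"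
    using \<kappa> by (intro exI[of _ \<delta>]) (auto simp: \<delta>_def)
qed

end
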